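(* Let $I\subset\mathbb{C}[x,y]$ be a normal monomial ideal of finite colength, and let $$I=\prod_{k=1}^{t}\mathfrak{n}_{\alpha_k,\beta_k}^{\delta_k}$$ be its unique factorisation with $\delta_k\geq1$, $\gcd(\alpha_k,\beta_k)=1$ and the pairs $(\alpha_k,\beta_k)$ pairwise distinct. Then there is a bijective correspondence between the set of ideals $\mathfrak{n}_{\alpha_k,\beta_k}^{\delta_k}$ appearing in this factorisation and the set of irreducible components of $E_I\mathbb{A}^2$, where $E_I\mathbb{A}^2$ is the exceptional divisor in the blowup of $\mathbb{A}^2$ with center the ideal $I$. In particular, if $J\subset\mathbb{C}[x,y]$ is an arbitrary monomial ideal of finite colength and $I=\overline{J}$ is its normalisation, then $E_J\mathbb{A}^2$ has at most $t$ irreducible components, where $t$ is the number of factors $\mathfrak{n}_{\alpha_k,\beta_k}^{\delta_k}$ in the unique factorisation $I=\prod_{k=1}^{t}\mathfrak{n}_{\alpha_k,\beta_k}^{\delta_k}$ of $I=\overline{J}$ with $\delta_k\geq1$, $\gcd(\alpha_k,\beta_k)=1$ and the pairs $(\alpha_k,\beta_k)$ pairwise distinct.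
   Context: For a monomial ideal $I\subset\mathbb{C}[x,y]$ of finite colength (i.e. $\dim_{\mathbb{C}}\mathbb{C}[x,y]/I<\infty$), its normalisation is the monomial ideal $\overline{I}$ generated by all monomials $x^ay^b$ such that $(x^ay^b)^p\in I^p$ for some $p\geq1$. The ideal $I$ is called normal if its Rees algebra $\bigoplus_{i\geq0}I^it^i\subset\mathbb{C}[x,y][t]$ is a normal domain (equivalently, $\operatorname{Bl}_I\mathbb{A}^2$ is normal, equivalently $I=\overline{I}$). For positive integers $h,k$, $\mathfrak{n}_{h,k}$ denotes the normalisation of the ideal $(x^h,y^k)$. It is known that every normal monomial ideal of finite colength in $\mathbb{C}[x,y]$ has a unique (up to reordering) factorisation as displayed in the claim. For an ideal $I$, the exceptional divisor $E_I\mathbb{A}^2\subset\operatorname{Bl}_I\mathbb{A}^2$ is the scheme-theoretic preimage of $V(I)$ under the blowup morphism $\operatorname{Bl}_I\mathbb{A}^2\to\mathbb{A}^2$. *)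

theory Defs
  imports
    "HOL-Computational_Algebra.Computational_Algebra"
    "HOL-Algebra.Ideal_Product"
    "HOL-Algebra.Embedded_Algebras"
    "HOL-Algebra.Algebraic_Closure_Type"
    "HOL-Analysis.Abstract_Topology"
begin

section \<open>Spectra and irreducible components\<close>

definition zero_locus :: "('a, 'b) ring_scheme \<Rightarrow> 'a set \<Rightarrow> 'a set set" where
  "zero_locus R S = {P. primeideal P R \<and> S \<subseteq> P}"

definition Spec :: "('a, 'b) ring_scheme \<Rightarrow> 'a set topology" where
  "Spec R = topology (\<lambda>U. \<exists>S \<subseteq> carrier R. U = {P. primeideal P R} - zero_locus R S)"

lemma istopology_Spec:
  "istopology (\<lambda>U. \<exists>S \<subseteq> carrier R. U = {P. primeideal P R} - zero_locus R S)"
  (is "istopology ?open")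
  unfolding istopology_def
proof (intro conjI allI impI)
  fix U V assume "?open U" "?open V"
  then obtain S T where S: "S \<subseteq> carrier R" "U = {P. primeideal P R} - zero_locus R S"
    and T: "T \<subseteq> carrier R" "V = {P. primeideal P R} - zero_locus R T" by blast
  define W where "W = {s \<otimes>\<^bsub>R\<^esub> t | s t. s \<in> S \<and> t \<in> T} \<inter> carrier R"
  have "W \<subseteq> P \<longleftrightarrow> S \<subseteq> P \<or> T \<subseteq> P" if P: "primeideal P R" for P
  proof -
    interpret primeideal P R by (rule P)
    have "S \<subseteq> P" if W: "W \<subseteq> P" and T': "\<not> T \<subseteq> P"
    proof
      fix s assume s: "s \<in> S"
      from T' obtain t where t: "t \<in> T" "t \<notin> P" by blast
      have carr: "s \<in> carrier R" "t \<in> carrier R" using s t S(1) T(1) by auto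
      then have "s \<otimes>\<^bsub>R\<^esub> t \<in> W" using s t by (auto simp: W_def)
      with W have "s \<otimes>\<^bsub>R\<^esub> t \<in> P" by blast
      from I_prime[OF carr this] t(2) show "s \<in> P" by simp
    qed
    moreover have "s \<otimes>\<^bsub>R\<^esub> t \<in> P" if "s \<in> S" "t \<in> T" "S \<subseteq> P \<or> T \<subseteq> P" for s t
    proof -
      have "s \<in> carrier R" "t \<in> carrier R" using that S(1) T(1) by auto
      with that show ?thesis by (meson I_l_closed I_r_closed subsetD)
    qed
    ultimately show ?thesis unfolding W_def by blast
  qed
  then have "U \<inter> V = {P. primeideal P R} - zero_locus R W"
    unfolding S(2) T(2) zero_locus_def by blast
  moreover have "W \<subseteq> carrier R" by (simp add: W_def)
  ultimately show "?open (U \<inter> V)" by blast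
next
  fix K assume K: "\<forall>U\<in>K. ?open U"
  obtain S where S: "\<And>U. U \<in> K \<Longrightarrow> S U \<subseteq> carrier R"
    "\<And>U. U \<in> K \<Longrightarrow> U = {P. primeideal P R} - zero_locus R (S U)"
    using bchoice[OF K] by blast
  have "P \<in> \<Union>K \<longleftrightarrow> P \<in> {P. primeideal P R} - zero_locus R (\<Union>(S ` K))" for P
  proof
    assume "P \<in> \<Union>K"
    then obtain U where U: "U \<in> K" "P \<in> U" by blast
    with S(2)[OF U(1)] show "P \<in> {P. primeideal P R} - zero_locus R (\<Union>(S ` K))"
      unfolding zero_locus_def by blast
  next
    assume "P \<in> {P. primeideal P R} - zero_locus R (\<Union>(S ` K))"
    then obtain U where U: "U \<in> K" "primeideal P R" "\<not> S U \<subseteq> P"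
      unfolding zero_locus_def by blast
    then have "P \<in> {P. primeideal P R} - zero_locus R (S U)"
      unfolding zero_locus_def by blast
    with S(2)[OF U(1)] U(1) show "P \<in> \<Union>K" by blast
  qed
  then have "\<Union>K = {P. primeideal P R} - zero_locus R (\<Union>(S ` K))" by (rule Set.set_eqI)
  moreover have "\<Union>(S ` K) \<subseteq> carrier R" using S(1) by blast
  ultimately show "?open (\<Union>K)" by blast
qed

lemma openin_Spec:
  "openin (Spec R) U \<longleftrightarrow> (\<exists>S \<subseteq> carrier R. U = {P. primeideal P R} - zero_locus R S)"
  unfolding Spec_def by (simp add: topology_inverse'[OF istopology_Spec])

definition irreducible_subset :: "'a topology \<Rightarrow> 'a set \<Rightarrow> bool" where
  "irreducible_subset T S \<longleftrightarrow> S \<subseteq> topspace T \<and> S \<noteq> {} \<and>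
     (\<forall>A B. closedin T A \<and> closedin T B \<and> S \<subseteq> A \<union> B \<longrightarrow> S \<subseteq> A \<or> S \<subseteq> B)"

definition irreducible_components :: "'a topology \<Rightarrow> 'a set set" where
  "irreducible_components T =
     {S. irreducible_subset T S \<and> (\<forall>S'. irreducible_subset T S' \<and> S \<subseteq> S' \<longrightarrow> S' = S)}"


section \<open>Normal domains\<close>

text \<open>For a subring \<open>A\<close> of an integral domain, the field of fractions of \<open>A\<close> is realised
  as a subset of the field of fractions of the ambient domain.\<close>

definition fraction_field :: "'a::idom set \<Rightarrow> 'a fract set" where
  "fraction_field A = {Fract a b | a b. a \<in> A \<and> b \<in> A \<and> b \<noteq> 0}"

definition integral_over :: "'a::idom set \<Rightarrow> 'a fract \<Rightarrow> bool" where
  "integral_over A z \<longleftrightarrow> (\<exists>p :: 'a fract Polynomial.poly.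
     Polynomial.lead_coeff p = 1 \<and> (\<forall>i. Polynomial.coeff p i \<in> to_fract ` A) \<and>
     Polynomial.poly p z = 0)"

definition normal_domain :: "'a::idom set \<Rightarrow> bool" where
  "normal_domain A \<longleftrightarrow> domain (ring_of_type_algebra\<lparr>carrier := A\<rparr>) \<and>
     (\<forall>z \<in> fraction_field A. integral_over A z \<longrightarrow> z \<in> to_fract ` A)"


section \<open>Monomial ideals in two variables\<close>

text \<open>\<open>\<complex>[x,y]\<close> is represented as \<open>\<complex>[x][y]\<close>.\<close>

type_synonym poly2 = "complex Polynomial.poly Polynomial.poly"

abbreviation Cxy :: "poly2 ring" where
  "Cxy \<equiv> ring_of_type_algebra"

definition xy_monom :: "nat \<Rightarrow> nat \<Rightarrow> poly2" where
  "xy_monom a b = Polynomial.monom (Polynomial.monom 1 a) b"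

abbreviation ideal_power :: "poly2 set \<Rightarrow> nat \<Rightarrow> poly2 set" where
  "ideal_power I n \<equiv> I [^]\<^bsub>ideals_set Cxy\<^esub> n"

definition monomial_ideal :: "poly2 set \<Rightarrow> bool" where
  "monomial_ideal I \<longleftrightarrow> (\<exists>M. I = Idl\<^bsub>Cxy\<^esub> {xy_monom a b | a b. (a, b) \<in> M})"

text \<open>The scalars act on the quotient through the cosets of the constant polynomials.
  For the unit ideal the quotient is the zero ring, which is of dimension \<open>0\<close>.\<close>

definition finite_colength :: "poly2 set \<Rightarrow> bool" where
  "finite_colength I \<longleftrightarrow>
     ring.finite_dimension (Cxy Quot I) (range (\<lambda>c. I +>\<^bsub>Cxy\<^esub> [:[:c:]:])) (carrier (Cxy Quot I))"

definition normalisation :: "poly2 set \<Rightarrow> poly2 set" where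
  "normalisation I =
     Idl\<^bsub>Cxy\<^esub> {xy_monom a b | a b. \<exists>p \<ge> 1. xy_monom a b ^ p \<in> ideal_power I p}"

definition nn :: "nat \<Rightarrow> nat \<Rightarrow> poly2 set" where
  "nn h k = normalisation (Idl\<^bsub>Cxy\<^esub> {xy_monom h 0, xy_monom 0 k})"

definition is_factorisation ::
  "poly2 set \<Rightarrow> nat \<Rightarrow> (nat \<Rightarrow> nat) \<Rightarrow> (nat \<Rightarrow> nat) \<Rightarrow> (nat \<Rightarrow> nat) \<Rightarrow> bool" where
  "is_factorisation I t \<alpha> \<beta> \<delta> \<longleftrightarrow>
     (\<forall>k \<in> {1..t}. \<alpha> k \<ge> 1 \<and> \<beta> k \<ge> 1 \<and> \<delta> k \<ge> 1 \<and> gcd (\<alpha> k) (\<beta> k) = 1) \<and>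
     inj_on (\<lambda>k. (\<alpha> k, \<beta> k)) {1..t} \<and>
     I = finprod (ideals_set Cxy) (\<lambda>k. ideal_power (nn (\<alpha> k) (\<beta> k)) (\<delta> k)) {1..t}"


section \<open>The blowup and its exceptional divisor\<close>

definition rees :: "poly2 set \<Rightarrow> poly2 Polynomial.poly set" where
  "rees I = {f. \<forall>i. Polynomial.coeff f i \<in> ideal_power I i}"

abbreviation rees_ring :: "poly2 set \<Rightarrow> poly2 Polynomial.poly ring" where
  "rees_ring I \<equiv> ring_of_type_algebra\<lparr>carrier := rees I\<rparr>"

definition normal_ideal :: "poly2 set \<Rightarrow> bool" where
  "normal_ideal I \<longleftrightarrow> normal_domain (rees I)"

definition homogeneous :: "poly2 Polynomial.poly set \<Rightarrow> bool" where
  "homogeneous P \<longleftrightarrow> (\<forall>f \<in> P. \<forall>i. Polynomial.monom (Polynomial.coeff f i) i \<in> P)"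

definition irrelevant_ideal :: "poly2 set \<Rightarrow> poly2 Polynomial.poly set" where
  "irrelevant_ideal I = {f \<in> rees I. Polynomial.coeff f 0 = 0}"

text \<open>The underlying topological space of \<open>Proj\<close> of the Rees algebra, which carries the topology
  induced from the spectrum.\<close>

definition blowup :: "poly2 set \<Rightarrow> poly2 Polynomial.poly set topology" where
  "blowup I = subtopology (Spec (rees_ring I)) {P. homogeneous P \<and> \<not> irrelevant_ideal I \<subseteq> P}"

text \<open>On points, the blowup morphism contracts a prime along the inclusion of \<open>\<complex>[x,y]\<close> as the
  part of degree \<open>0\<close>.\<close>

definition blowup_map :: "poly2 Polynomial.poly set \<Rightarrow> poly2 set" where
  "blowup_map P = {f. [:f:] \<in> P}"

text \<open>The underlying topological space of the scheme-theoretic preimage of \<open>V(I)\<close> is the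
  set-theoretic preimage; irreducible components depend only on this space.\<close>

definition exceptional_divisor :: "poly2 set \<Rightarrow> poly2 Polynomial.poly set topology" where
  "exceptional_divisor I = subtopology (blowup I) {P. blowup_map P \<in> zero_locus Cxy I}"

end

theory Submission
  imports Defs "HOL-Library.Set_Algebras" "HOL-Library.Product_Plus"
begin

text \<open>A monomial ideal of \<open>\<complex>[x,y]\<close> is determined by the up-closed set \<open>U\<close> of exponents of its monomials,
  and products, powers and the normalisation turn into operations on such sets
  (\<open>exponent_ideal_prod\<close>, \<open>exponent_ideal_power\<close>, \<open>normalisation_exponent_ideal\<close>). A factor
  \<open>ideal_power (nn \<alpha> \<beta>) \<delta>\<close> contributes to the Newton polygon a compact edge of direction \<open>(\<delta>\<alpha>, -\<delta>\<beta>)\<close>, and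
  the polygon of the product is the Minkowski sum, so its compact edges correspond to the factors.

  The edge of the \<open>k\<close>-th factor has the inner normal \<open>(\<beta>\<^sub>k, \<alpha>\<^sub>k)\<close> and thus defines a monomial
  valuation \<open>v\<^sub>k\<close>; let \<open>m\<^sub>k > 0\<close> be its minimum on the ideal. Its centre on the blowup is the
  homogeneous prime \<open>P\<^sub>k\<close> of the Rees algebra spanned by the monomials \<open>x\<^sup>ay\<^sup>bt\<^sup>i\<close> with
  \<open>v\<^sub>k(x\<^sup>ay\<^sup>b) > i m\<^sub>k\<close> (\<open>primeideal_center\<close>). The \<open>P\<^sub>k\<close> are the generic points of the components of the
  exceptional divisor, for two reasons.

  \<^item> They are pairwise incomparable (\<open>generic_point_incomparable\<close>), because for two distinct edges
    one end of the one edge does not lie on the other edge.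

  \<^item> Every point \<open>P\<close> of the exceptional divisor contains some \<open>P\<^sub>k\<close> (\<open>contains_generic_point\<close>).
    Otherwise there is for each \<open>k\<close> a monomial of \<open>P\<^sub>k\<close> outside \<open>P\<close>. The product of these monomials is
    outside \<open>P\<close>, and its exponent lies strictly above all compact edges of the corresponding multiple
    of the Newton polygon. Hence some power of it lies in the extension of the ideal to the Rees
    algebra, which is contained in \<open>P\<close>. The passage from the inequalities defining the polygon to a power of the
    ideal (\<open>power_in_npow\<close>) is a fractional knapsack argument.

  The argument needs the vertices of the polygon to be exponents of the ideal only up to powers,
  as is the case for an ideal whose normalisation has this polygon. It therefore applies in the
  same way to an ideal that factors itself and to an ideal whose normalisation factors, and in both
  cases there are exactly as many components as factors.\<close>

section \<open>Subrings of commutative rings as carriers\<close>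

lemma type_ring_simps [simp]:
  "carrier ring_of_type_algebra = UNIV"
  "monoid.mult ring_of_type_algebra = (*)" "one ring_of_type_algebra = 1"
  "ring.zero ring_of_type_algebra = 0" "add ring_of_type_algebra = (+)"
  by (simp_all add: ring_of_type_algebra_def fun_eq_iff)

lemma type_ring_carrier_UNIV: "ring_of_type_algebra\<lparr>carrier := UNIV\<rparr> = ring_of_type_algebra"
  by (simp add: ring_of_type_algebra_def)

definition is_subring :: "'a::comm_ring_1 set \<Rightarrow> bool" where
  "is_subring A \<longleftrightarrow> 1 \<in> A \<and> (\<forall>f\<in>A. - f \<in> A) \<and> (\<forall>f\<in>A. \<forall>g\<in>A. f + g \<in> A) \<and> (\<forall>f\<in>A. \<forall>g\<in>A. f * g \<in> A)"

lemma cring_subring: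
  fixes A :: "'a::comm_ring_1 set"
  assumes "is_subring A"
  shows "cring (ring_of_type_algebra\<lparr>carrier := A\<rparr>)"
proof -
  interpret cring "ring_of_type_algebra :: 'a ring" by (rule cring_from_type_algebra)
  have "\<ominus>\<^bsub>ring_of_type_algebra\<^esub> x = - x" for x :: 'a
    using minus_equality[of "- x" x] by simp
  then have "subcring A ring_of_type_algebra"
    using assms by (intro subcringI' subringI) (auto simp: is_subring_def)
  then show ?thesis by (simp add: subcring_iff)
qed

lemma ideal_subring_iff:
  fixes A :: "'a::comm_ring_1 set"
  assumes A: "is_subring A"
  shows "ideal I (ring_of_type_algebra\<lparr>carrier := A\<rparr>) \<longleftrightarrow>
    I \<subseteq> A \<and> 0 \<in> I \<and> (\<forall>f\<in>I. \<forall>g\<in>I. f + g \<in> I) \<and> (\<forall>f\<in>I. \<forall>r\<in>A. r * f \<in> I)" (is "ideal I ?R \<longleftrightarrow> ?rhs")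
proof
  assume "ideal I ?R"
  then show ?rhs
    using additive_subgroup.zero_closed[OF ideal.axioms(1), of I ?R]
      additive_subgroup.a_subset[OF ideal.axioms(1), of I ?R]
      additive_subgroup.a_closed[OF ideal.axioms(1), of I ?R] ideal.I_l_closed[of I ?R] by simp
next
  assume *: ?rhs
  interpret cring ?R by (rule cring_subring[OF A])
  have neg: "\<ominus>\<^bsub>?R\<^esub> x \<in> I" if x: "x \<in> I" for x
  proof -
    have "- 1 \<in> A" using A by (simp add: is_subring_def)
    then have "(- 1) * x \<in> I" using * x by blast
    then have "- x \<in> I" by simp
    moreover have "x \<in> A" "- x \<in> A" using * x calculation by blast+
    then have "\<ominus>\<^bsub>?R\<^esub> x = - x" using minus_equality[of "- x" x] by simp
    ultimately show ?thesis by simp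
  qed
  show "ideal I ?R"
  proof (rule idealI)
    show "ring ?R" by (rule ring_axioms)
    show "subgroup I (add_monoid ?R)"
      by (rule add.subgroupI) (use * neg in auto)
  qed (use * in \<open>auto simp: mult.commute\<close>)
qed

lemma primeideal_subring_iff:
  fixes A :: "'a::comm_ring_1 set"
  assumes A: "is_subring A"
  shows "primeideal P (ring_of_type_algebra\<lparr>carrier := A\<rparr>) \<longleftrightarrow>
    (P \<subseteq> A \<and> 0 \<in> P \<and> (\<forall>f\<in>P. \<forall>g\<in>P. f + g \<in> P) \<and> (\<forall>f\<in>P. \<forall>r\<in>A. r * f \<in> P)) \<and>
    1 \<notin> P \<and> (\<forall>f\<in>A. \<forall>g\<in>A. f * g \<in> P \<longrightarrow> f \<in> P \<or> g \<in> P)" (is "primeideal P ?R \<longleftrightarrow> ?ideal \<and> ?prime")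
proof -
  have "1 \<notin> P \<longleftrightarrow> A \<noteq> P" if ?ideal
  proof -
    have "A \<subseteq> P" if "1 \<in> P"
    proof
      fix r assume "r \<in> A"
      then have "r * 1 \<in> P" using \<open>?ideal\<close> \<open>1 \<in> P\<close> by blast
      then show "r \<in> P" by simp
    qed
    then show ?thesis using that A by (auto simp: is_subring_def)
  qed
  then show ?thesis
    using cring_subring[OF A]
    by (auto simp: primeideal_def primeideal_axioms_def ideal_subring_iff[OF A])
qed

lemma is_subring_UNIV: "is_subring UNIV"
  by (simp add: is_subring_def)

lemmas Cxy_ideal_iff = ideal_subring_iff[OF is_subring_UNIV, unfolded type_ring_carrier_UNIV, simplified]
lemmas Cxy_primeideal_iff = primeideal_subring_iff[OF is_subring_UNIV, unfolded type_ring_carrier_UNIV, simplified]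

lemma cring_Cxy: "cring Cxy"
  by (rule cring_from_type_algebra)

section \<open>Monomial ideals and sets of exponents\<close>

definition coeff2 :: "poly2 \<Rightarrow> nat \<Rightarrow> nat \<Rightarrow> complex" where
  "coeff2 f a b = Polynomial.coeff (Polynomial.coeff f b) a"

lemma coeff2_simps [simp]:
  "coeff2 0 a b = 0" "coeff2 (f + g) a b = coeff2 f a b + coeff2 g a b"
  "coeff2 (sum F A) a b = (\<Sum>x\<in>A. coeff2 (F x) a b)"
  by (simp_all add: coeff2_def coeff_sum)

lemma coeff2_mult:
  "coeff2 (f * g) a b = (\<Sum>j\<le>b. \<Sum>i\<le>a. coeff2 f i j * coeff2 g (a - i) (b - j))"
  by (simp add: coeff2_def Polynomial.coeff_mult coeff_sum)

lemma coeff2_xy_monom: "coeff2 (xy_monom a b) i j = (if i = a \<and> j = b then 1 else 0)"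
  by (simp add: coeff2_def xy_monom_def)

lemma coeff2_eqI: "(\<And>a b. coeff2 f a b = coeff2 g a b) \<Longrightarrow> f = g"
  by (intro poly_eqI) (simp add: coeff2_def)

lemma xy_monom_mult: "xy_monom a b * xy_monom c d = xy_monom (a + c) (b + d)"
  by (simp add: xy_monom_def mult_monom)

lemma xy_monom_0: "xy_monom 0 0 = 1"
  by (simp add: xy_monom_def)

lemma xy_monom_power: "xy_monom a b ^ n = xy_monom (n * a) (n * b)"
  by (induction n) (simp_all add: xy_monom_0 xy_monom_mult)

lemma coeff2_scale: "coeff2 ([:[:c:]:] * f) a b = c * coeff2 f a b"
  by (simp add: coeff2_def)

lemma poly2_expand:
  "f = (\<Sum>b\<le>Polynomial.degree f. \<Sum>a\<le>Polynomial.degree (Polynomial.coeff f b).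
          [:[:coeff2 f a b:]:] * xy_monom a b)"
proof (rule coeff2_eqI)
  fix i j
  have "(\<Sum>b\<le>Polynomial.degree f. \<Sum>a\<le>Polynomial.degree (Polynomial.coeff f b).
          coeff2 f a b * coeff2 (xy_monom a b) i j)
      = (\<Sum>b\<le>Polynomial.degree f. if b = j then coeff2 f i j else 0)"
  proof (rule sum.cong[OF refl])
    fix b
    have "(\<Sum>a\<le>Polynomial.degree (Polynomial.coeff f b). coeff2 f a b * coeff2 (xy_monom a b) i j)
      = (\<Sum>a\<le>Polynomial.degree (Polynomial.coeff f b). if a = i then
          (if b = j then coeff2 f i j else 0) else 0)"
      by (rule sum.cong) (auto simp: coeff2_xy_monom)
    also have "\<dots> = (if b = j then coeff2 f i j else 0)"
      by (auto simp: sum.delta coeff2_def intro: Polynomial.coeff_eq_0)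
    finally show "(\<Sum>a\<le>Polynomial.degree (Polynomial.coeff f b). coeff2 f a b * coeff2 (xy_monom a b) i j)
       = (if b = j then coeff2 f i j else 0)" .
  qed
  also have "\<dots> = coeff2 f i j"
    by (auto simp: sum.delta coeff2_def Polynomial.coeff_eq_0)
  finally show "coeff2 f i j = coeff2 (\<Sum>b\<le>Polynomial.degree f.
      \<Sum>a\<le>Polynomial.degree (Polynomial.coeff f b). [:[:coeff2 f a b:]:] * xy_monom a b) i j"
    by (simp only: coeff2_simps coeff2_scale)
qed

text \<open>Since the scalars lie in \<open>\<complex>[x,y]\<close>, membership of polynomials can be checked on their monomials.\<close>

lemma ideal_mem_if_monoms:
  assumes I: "ideal I Cxy" and f: "\<And>a b. coeff2 f a b \<noteq> 0 \<Longrightarrow> xy_monom a b \<in> I"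
  shows "f \<in> I"
proof -
  have sum: "sum F A \<in> I" if "\<And>x. x \<in> A \<Longrightarrow> F x \<in> I" for A :: "nat set" and F
    using that I by (induction A rule: infinite_finite_induct) (auto simp: Cxy_ideal_iff)
  have "[:[:coeff2 f a b:]:] * xy_monom a b \<in> I" for a b
    using f[of a b] I by (cases "coeff2 f a b = 0") (auto simp: Cxy_ideal_iff simp del: mult_pCons_left)
  then show ?thesis
    by (subst poly2_expand) (intro sum)
qed

definition up_closed :: "(nat \<times> nat) set \<Rightarrow> bool" where
  "up_closed U \<longleftrightarrow> (\<forall>u\<in>U. \<forall>v. u + v \<in> U)"

text \<open>For up-closed \<open>U\<close> this is the monomial ideal whose monomials are exactly those with exponent in \<open>U\<close>.\<close>

definition exponent_ideal :: "(nat \<times> nat) set \<Rightarrow> poly2 set" where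
  "exponent_ideal U = {f. \<forall>a b. coeff2 f a b \<noteq> 0 \<longrightarrow> (a, b) \<in> U}"

lemma exponent_idealD: "f \<in> exponent_ideal U \<Longrightarrow> coeff2 f a b \<noteq> 0 \<Longrightarrow> (a, b) \<in> U"
  by (simp add: exponent_ideal_def)

lemma exponent_plusE:
  fixes U V :: "(nat \<times> nat) set"
  assumes "(a, b) \<in> U + V"
  obtains c d e g where "a = c + e" "b = d + g" "(c, d) \<in> U" "(e, g) \<in> V"
  using assms by (elim set_plus_elim) (metis add_Pair prod.exhaust prod.inject)

lemma xy_monom_in_exponent_ideal [simp]: "xy_monom a b \<in> exponent_ideal U \<longleftrightarrow> (a, b) \<in> U"
  by (auto simp: exponent_ideal_def coeff2_xy_monom)

lemma exponent_ideal_inject: "exponent_ideal U = exponent_ideal V \<longleftrightarrow> U = V"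
  by (metis Set.set_eqI prod.exhaust xy_monom_in_exponent_ideal)

lemma up_closedD: "up_closed U \<Longrightarrow> (a, b) \<in> U \<Longrightarrow> a \<le> c \<Longrightarrow> b \<le> d \<Longrightarrow> (c, d) \<in> U"
  unfolding up_closed_def by (drule (1) bspec, drule spec[of _ "(c - a, d - b)"]) simp

lemma up_closed_UNIV: "up_closed UNIV"
  by (simp add: up_closed_def)

lemma up_closed_plus: "up_closed V \<Longrightarrow> up_closed (U + V)"
  unfolding up_closed_def by (auto elim!: set_plus_elim) (metis add.assoc set_plus_intro add_Pair)

lemma exponent_ideal_mult:
  assumes "f \<in> exponent_ideal U" "g \<in> exponent_ideal V"
  shows "f * g \<in> exponent_ideal (U + V)"
  unfolding exponent_ideal_def
proof safe
  fix a b assume "coeff2 (f * g) a b \<noteq> 0"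
  then obtain i j where ij: "i \<le> a" "j \<le> b" "coeff2 f i j \<noteq> 0" "coeff2 g (a - i) (b - j) \<noteq> 0"
    unfolding coeff2_mult by (metis (no_types, lifting) atMost_iff mult_zero_left mult_zero_right sum.neutral)
  then have "(i, j) + (a - i, b - j) \<in> U + V"
    using assms by (intro set_plus_intro) (auto simp: exponent_ideal_def)
  then show "(a, b) \<in> U + V" using ij by simp
qed

lemma plus_UNIV_up_closed: "up_closed U \<Longrightarrow> UNIV + U = U"
proof
  assume U: "up_closed U"
  show "UNIV + U \<subseteq> U"
    using U by (auto elim!: set_plus_elim simp: up_closed_def) (metis add.commute add_Pair)
  show "U \<subseteq> UNIV + U"
    using set_plus_intro[of 0 UNIV _ U] by force
qed

lemma ideal_exponent_ideal:
  assumes "up_closed U"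
  shows "ideal (exponent_ideal U) Cxy"
proof -
  have "r * f \<in> exponent_ideal U" if "f \<in> exponent_ideal U" for r f
    using exponent_ideal_mult[of r UNIV f U] that plus_UNIV_up_closed[OF assms]
    by (simp add: exponent_ideal_def[of UNIV])
  moreover have "f + g \<in> exponent_ideal U"
    if "f \<in> exponent_ideal U" "g \<in> exponent_ideal U" for f g
    using that unfolding exponent_ideal_def by force
  moreover have "0 \<in> exponent_ideal U" by (simp add: exponent_ideal_def)
  ultimately show ?thesis
    by (simp add: Cxy_ideal_iff)
qed

text \<open>Adding \<open>UNIV\<close>, that is the cone of all exponents, is the passage to the up-closure.\<close>

lemma genideal_xy_monoms:
  "Idl\<^bsub>Cxy\<^esub> {xy_monom a b | a b. (a, b) \<in> M} = exponent_ideal (UNIV + M)" (is "?L = ?R")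
proof
  interpret cring Cxy by (rule cring_Cxy)
  have "up_closed (UNIV + M)"
    by (subst add.commute) (rule up_closed_plus[OF up_closed_UNIV])
  then have id: "ideal ?R Cxy" by (rule ideal_exponent_ideal)
  have "(0, 0) + u \<in> UNIV + M" if "u \<in> M" for u
    using that by (intro set_plus_intro) auto
  then show "?L \<subseteq> ?R"
    by (intro genideal_minimal[OF id]) auto
  show "?R \<subseteq> ?L"
  proof
    fix f assume f: "f \<in> ?R"
    have L: "ideal ?L Cxy" by (rule genideal_ideal) simp
    have "{xy_monom a b | a b. (a, b) \<in> M} \<subseteq> ?L" by (rule genideal_self) simp
    then have gen: "xy_monom a b \<in> ?L" if "(a, b) \<in> M" for a b using that by blast
    show "f \<in> ?L"
    proof (rule ideal_mem_if_monoms[OF L])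
      fix a b assume "coeff2 f a b \<noteq> 0"
      then obtain c d e g where *: "a = c + e" "b = d + g" "(e, g) \<in> M"
        using exponent_idealD[OF f] by (blast elim: exponent_plusE)
      then have "xy_monom c d * xy_monom e g \<in> ?L"
        using L gen[of e g] unfolding Cxy_ideal_iff by blast
      then show "xy_monom a b \<in> ?L" using * by (simp add: xy_monom_mult)
    qed
  qed
qed

lemma monomial_idealE:
  assumes "monomial_ideal I"
  obtains U where "up_closed U" "I = exponent_ideal U"
  using assms up_closed_plus[OF up_closed_UNIV] unfolding monomial_ideal_def genideal_xy_monoms
  by (metis add.commute)

lemma exponent_ideal_prod:
  assumes "up_closed U" "up_closed V"
  shows "ideal_prod Cxy (exponent_ideal U) (exponent_ideal V) = exponent_ideal (U + V)"
proof
  interpret cring Cxy by (rule cring_Cxy)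
  have id: "ideal (exponent_ideal U) Cxy" "ideal (exponent_ideal V) Cxy" "ideal (exponent_ideal (U + V)) Cxy"
    using assms by (auto intro: ideal_exponent_ideal up_closed_plus)
  show "ideal_prod Cxy (exponent_ideal U) (exponent_ideal V) \<subseteq> exponent_ideal (U + V)"
  proof
    fix f assume "f \<in> ideal_prod Cxy (exponent_ideal U) (exponent_ideal V)"
    then show "f \<in> exponent_ideal (U + V)"
    proof induction
      case (prod i j) then show ?case by (simp add: exponent_ideal_mult)
    next
      case (sum s1 s2) then show ?case using id(3) by (simp add: Cxy_ideal_iff)
    qed
  qed
  show "exponent_ideal (U + V) \<subseteq> ideal_prod Cxy (exponent_ideal U) (exponent_ideal V)"
  proof
    fix f assume f: "f \<in> exponent_ideal (U + V)"
    show "f \<in> ideal_prod Cxy (exponent_ideal U) (exponent_ideal V)"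
    proof (rule ideal_mem_if_monoms[OF ideal_prod_is_ideal[OF id(1,2)]])
      fix a b assume "coeff2 f a b \<noteq> 0"
      then obtain c d e g where *: "a = c + e" "b = d + g" "(c, d) \<in> U" "(e, g) \<in> V"
        using exponent_idealD[OF f] by (blast elim: exponent_plusE)
      then have "xy_monom c d \<otimes>\<^bsub>Cxy\<^esub> xy_monom e g \<in> ideal_prod Cxy (exponent_ideal U) (exponent_ideal V)"
        by (intro ideal_prod.prod) auto
      then show "xy_monom a b \<in> ideal_prod Cxy (exponent_ideal U) (exponent_ideal V)"
        using * by (simp add: xy_monom_mult)
    qed
  qed
qed

text \<open>The \<open>n\<close>-fold Minkowski sum. The recursion starts from \<open>UNIV\<close> and not from \<open>{0}\<close>, as the zeroth power
  of an ideal is the unit ideal.\<close>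

primrec npow :: "(nat \<times> nat) set \<Rightarrow> nat \<Rightarrow> (nat \<times> nat) set" where
  "npow U 0 = UNIV"
| "npow U (Suc n) = npow U n + U"

lemma up_closed_npow: "up_closed U \<Longrightarrow> up_closed (npow U n)"
  by (induction n) (auto intro: up_closed_plus up_closed_UNIV)

lemma ideals_set_simps [simp]:
  "carrier (ideals_set R) = {I. ideal I R}" "monoid.mult (ideals_set R) = ideal_prod R"
  "one (ideals_set R) = carrier R"
  by (simp_all add: ideals_set_def)

lemma exponent_ideal_power: "up_closed U \<Longrightarrow> ideal_power (exponent_ideal U) n = exponent_ideal (npow U n)"
proof (induction n)
  case 0 show ?case by (simp add: nat_pow_def exponent_ideal_def ideals_set_def)
next
  case (Suc n)
  then show ?case
    by (simp add: exponent_ideal_prod up_closed_npow nat_pow_def)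
qed

lemma npow_add:
  assumes "up_closed U"
  shows "npow U (m + n) = npow U m + npow U n"
  by (induction n) (simp_all add: add.assoc plus_UNIV_up_closed[OF up_closed_npow[OF assms]] add.commute[of _ UNIV])

lemma npow_scale:
  assumes U: "up_closed U" and z: "(a, b) \<in> npow U m"
  shows "(n * a, n * b) \<in> npow U (n * m)"
proof (induction n)
  case (Suc n)
  then have "(a, b) + (n * a, n * b) \<in> npow U m + npow U (n * m)"
    using z by (intro set_plus_intro)
  then show ?case by (simp add: npow_add[OF U])
qed simp

lemma npow_antimono:
  assumes "up_closed U" "m \<le> n"
  shows "npow U n \<subseteq> npow U m"
proof -
  have "npow U (m + (n - m)) \<subseteq> npow U m"
    unfolding npow_add[OF assms(1)]
    using up_closed_npow[OF assms(1), of m] by (auto elim!: set_plus_elim simp: up_closed_def)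
  then show ?thesis using assms by simp
qed

text \<open>The exponents of the normalisation.\<close>

definition npow_closure :: "(nat \<times> nat) set \<Rightarrow> (nat \<times> nat) set" where
  "npow_closure U = {(a, b). \<exists>p\<ge>1. (p * a, p * b) \<in> npow U p}"

lemma up_closed_npow_closure: 
  assumes "up_closed U" shows "up_closed (npow_closure U)"
  unfolding up_closed_def npow_closure_def
  by clarsimp (metis up_closedD[OF up_closed_npow[OF assms]] distrib_left le_add1)

lemma normalisation_exponent_ideal:
  assumes "up_closed U"
  shows "normalisation (exponent_ideal U) = exponent_ideal (npow_closure U)"
proof -
  have "normalisation (exponent_ideal U) = Idl\<^bsub>Cxy\<^esub> {xy_monom a b | a b. (a, b) \<in> npow_closure U}"
    unfolding normalisation_def npow_closure_def
    by (simp add: exponent_ideal_power[OF assms] xy_monom_power)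
  then show ?thesis
    by (simp add: genideal_xy_monoms plus_UNIV_up_closed up_closed_npow_closure assms)
qed

lemma subset_npow_closure: "up_closed U \<Longrightarrow> U \<subseteq> npow_closure U"
  unfolding npow_closure_def by (auto intro!: exI[of _ 1] simp: plus_UNIV_up_closed)

section \<open>Generic points\<close>

lemma irreducible_subset_finite_cover:
  assumes "irreducible_subset T S" "finite K" "\<And>k. k \<in> K \<Longrightarrow> closedin T (C k)" "S \<subseteq> (\<Union>k\<in>K. C k)"
  shows "\<exists>k\<in>K. S \<subseteq> C k"
  using assms(2-4)
proof (induction K rule: finite_induct)
  case empty
  then show ?case using assms(1) by (auto simp: irreducible_subset_def)
next
  case (insert k K)
  have "closedin T (\<Union>k\<in>K. C k)" using insert by (intro closedin_Union) auto
  then have "S \<subseteq> C k \<or> S \<subseteq> (\<Union>k\<in>K. C k)"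
    using assms(1) insert.prems unfolding irreducible_subset_def by auto
  then show ?case using insert by auto
qed

text \<open>The closure of a point is irreducible, and by the finite cover every irreducible set lies in one of
  these closures. Hence the maximal irreducible sets are those closures that are not contained in
  another one; incomparability of the points says that none is.\<close>

lemma irreducible_components_generic_points:
  assumes fin: "finite K"
    and cover: "topspace T = (\<Union>k\<in>K. Abstract_Topology.closure_of T {p k})"
    and pts: "\<And>k. k \<in> K \<Longrightarrow> p k \<in> topspace T"
    and incomp: "\<And>k l. k \<in> K \<Longrightarrow> l \<in> K \<Longrightarrow> p k \<in> Abstract_Topology.closure_of T {p l} \<Longrightarrow> k = l"
  shows "irreducible_components T = (\<lambda>k. Abstract_Topology.closure_of T {p k}) ` K"
    and "inj_on (\<lambda>k. Abstract_Topology.closure_of T {p k}) K"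
proof -
  define C where "C k = Abstract_Topology.closure_of T {p k}" for k
  have p: "p k \<in> C k" if "k \<in> K" for k
    using closure_of_subset[of "{p k}" T] pts[OF that] by (simp add: C_def)
  have irr: "irreducible_subset T (C k)" if k: "k \<in> K" for k
    unfolding irreducible_subset_def
  proof (intro conjI allI impI)
    show "C k \<subseteq> topspace T" by (simp add: C_def closure_of_subset_topspace)
    show "C k \<noteq> {}" using p[OF k] by blast
    fix A B assume "closedin T A \<and> closedin T B \<and> C k \<subseteq> A \<union> B"
    then show "C k \<subseteq> A \<or> C k \<subseteq> B"
      using p[OF k] closure_of_minimal[of "{p k}" _ T] unfolding C_def by auto
  qed
  have sub: "\<exists>k\<in>K. S \<subseteq> C k" if "irreducible_subset T S" for S
  proof (rule irreducible_subset_finite_cover[OF that fin])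
    show "S \<subseteq> (\<Union>k\<in>K. C k)" using that by (simp add: irreducible_subset_def cover C_def)
  qed (simp add: C_def)
  have eq: "k = l" if "k \<in> K" "l \<in> K" "C k \<subseteq> C l" for k l
    using that p incomp by (auto simp: C_def)
  show "inj_on (\<lambda>k. Abstract_Topology.closure_of T {p k}) K"
    using eq by (auto simp: inj_on_def C_def)
  show "irreducible_components T = (\<lambda>k. Abstract_Topology.closure_of T {p k}) ` K"
    unfolding C_def[symmetric]
  proof (intro Set.equalityI subsetI)
    fix S assume "S \<in> irreducible_components T"
    then have S: "irreducible_subset T S" "\<And>S'. irreducible_subset T S' \<Longrightarrow> S \<subseteq> S' \<Longrightarrow> S' = S"
      by (auto simp: irreducible_components_def)
    with sub obtain k where "k \<in> K" "S \<subseteq> C k" by blast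
    with S(2)[OF irr] show "S \<in> C ` K" by blast
  next
    fix S assume "S \<in> C ` K"
    then obtain k where k: "k \<in> K" "S = C k" by blast
    have "S' = C k" if S': "irreducible_subset T S'" "C k \<subseteq> S'" for S'
    proof -
      obtain l where l: "l \<in> K" "S' \<subseteq> C l" using sub[OF S'(1)] by blast
      then have "k = l" using eq k S' by blast
      then show ?thesis using l S' by blast
    qed
    then show "S \<in> irreducible_components T"
      using irr k by (auto simp: irreducible_components_def)
  qed
qed

lemma topspace_Spec: "topspace (Spec R) = {P. primeideal P R}"
proof -
  have "P \<notin> zero_locus R (carrier R)" if "primeideal P R" for P
    using primeideal.I_notcarr[OF that] additive_subgroup.a_subset[OF ideal.axioms(1)[OF primeideal.axioms(1)[OF that]]]
    by (auto simp: zero_locus_def)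
  then have "openin (Spec R) {P. primeideal P R}"
    unfolding openin_Spec by (intro exI[of _ "carrier R"]) auto
  moreover have "U \<subseteq> {P. primeideal P R}" if "openin (Spec R) U" for U
    using that unfolding openin_Spec by blast
  ultimately show ?thesis
    by (meson Set.equalityI openin_subset openin_topspace)
qed

text \<open>Specialisation in a spectrum is inclusion of primes, and this persists for subspaces.\<close>

lemma closure_of_Spec_point:
  assumes "P \<in> A" "primeideal P R"
  shows "Abstract_Topology.closure_of (subtopology (Spec R) A) {P} = {Q \<in> A. primeideal Q R \<and> P \<subseteq> Q}"
proof -
  have carr: "P \<subseteq> carrier R"
    using additive_subgroup.a_subset[OF ideal.axioms(1)[OF primeideal.axioms(1)[OF assms(2)]]] .
  have sub: "P \<subseteq> Q" if "primeideal Q R"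
    and *: "\<And>T. openin (Spec R) T \<Longrightarrow> Q \<in> T \<Longrightarrow> P \<in> T" for Q
  proof (rule ccontr)
    assume "\<not> P \<subseteq> Q"
    then have "Q \<in> {P. primeideal P R} - zero_locus R P" using that by (simp add: zero_locus_def)
    moreover have "openin (Spec R) ({P. primeideal P R} - zero_locus R P)"
      unfolding openin_Spec using carr by blast
    ultimately show False using *[of "{P. primeideal P R} - zero_locus R P"] by (auto simp: zero_locus_def)
  qed
  have nbhd: "P \<in> T" if "P \<subseteq> Q" "openin (Spec R) T" "Q \<in> T" for Q T
    using that assms unfolding openin_Spec zero_locus_def by blast
  show ?thesis
  proof (intro Set.set_eqI iffI)
    fix Q assume "Q \<in> Abstract_Topology.closure_of (subtopology (Spec R) A) {P}"
    then have Q: "Q \<in> A" "primeideal Q R"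
      and *: "\<And>T. openin (subtopology (Spec R) A) T \<Longrightarrow> Q \<in> T \<Longrightarrow> P \<in> T"
      by (auto simp: in_closure_of topspace_Spec)
    have "P \<in> T" if "openin (Spec R) T" "Q \<in> T" for T
      using *[of "A \<inter> T"] that Q(1) by (auto simp: openin_subtopology_Int2)
    then show "Q \<in> {Q \<in> A. primeideal Q R \<and> P \<subseteq> Q}" using sub[OF Q(2)] Q by simp
  next
    fix Q assume "Q \<in> {Q \<in> A. primeideal Q R \<and> P \<subseteq> Q}"
    then have Q: "Q \<in> A" "primeideal Q R" "P \<subseteq> Q" by auto
    have "P \<in> T" if "openin (subtopology (Spec R) A) T" "Q \<in> T" for T
      using that nbhd[OF Q(3)] assms(1) by (auto simp: openin_subtopology)
    then show "Q \<in> Abstract_Topology.closure_of (subtopology (Spec R) A) {P}"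
      using Q(1,2) by (simp add: in_closure_of topspace_Spec)
  qed
qed

section \<open>The Rees algebra of a monomial ideal\<close>

definition coeff3 :: "poly2 Polynomial.poly \<Rightarrow> nat \<Rightarrow> nat \<Rightarrow> nat \<Rightarrow> complex" where
  "coeff3 F i a b = coeff2 (Polynomial.coeff F i) a b"

lemma coeff3_simps [simp]:
  "coeff3 0 i a b = 0" "coeff3 (F + G) i a b = coeff3 F i a b + coeff3 G i a b"
  "coeff3 (- F) i a b = - coeff3 F i a b"
  "coeff3 1 i a b = (if i = 0 \<and> a = 0 \<and> b = 0 then 1 else 0)"
  "coeff3 (Polynomial.monom f j) i a b = (if i = j then coeff2 f a b else 0)"
  by (auto simp: coeff3_def coeff2_def)

lemma coeff3_mult:
  "coeff3 (F * G) i a b =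
    (\<Sum>h\<le>i. \<Sum>d\<le>b. \<Sum>c\<le>a. coeff3 F h c d * coeff3 G (i - h) (a - c) (b - d))"
  by (simp add: coeff3_def Polynomial.coeff_mult[of F] coeff2_mult)

lemma coeff3_eqI: "(\<And>i a b. coeff3 F i a b = coeff3 G i a b) \<Longrightarrow> F = G"
  by (intro poly_eqI coeff2_eqI) (simp add: coeff3_def)

text \<open>The Rees algebra is again spanned by monomials \<open>x\<^sup>ay\<^sup>bt\<^sup>i\<close>.\<close>

lemma rees_iff:
  assumes "up_closed U"
  shows "F \<in> rees (exponent_ideal U) \<longleftrightarrow> (\<forall>i a b. coeff3 F i a b \<noteq> 0 \<longrightarrow> (a, b) \<in> npow U i)"
  unfolding rees_def exponent_ideal_power[OF assms]
  by (simp add: exponent_ideal_def coeff3_def)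

lemma coeff3_mult_nonzeroE:
  assumes "coeff3 (F * G) i a b \<noteq> 0"
  obtains h c d i' c' d' where "i = h + i'" "a = c + c'" "b = d + d'" "coeff3 F h c d \<noteq> 0"
    "coeff3 G i' c' d' \<noteq> 0"
proof -
  obtain h where h: "h \<le> i"
    "(\<Sum>d\<le>b. \<Sum>c\<le>a. coeff3 F h c d * coeff3 G (i - h) (a - c) (b - d)) \<noteq> 0"
    using assms unfolding coeff3_mult by (metis (no_types, lifting) atMost_iff sum.neutral)
  then obtain d where d: "d \<le> b"
    "(\<Sum>c\<le>a. coeff3 F h c d * coeff3 G (i - h) (a - c) (b - d)) \<noteq> 0"
    by (metis (no_types, lifting) atMost_iff sum.neutral)
  then obtain c where "c \<le> a" "coeff3 F h c d * coeff3 G (i - h) (a - c) (b - d) \<noteq> 0"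
    by (metis (no_types, lifting) atMost_iff sum.neutral)
  then show ?thesis using that[of h "i - h" c "a - c" d "b - d"] h(1) d(1) by simp
qed

lemma is_subring_rees:
  assumes U: "up_closed U"
  shows "is_subring (rees (exponent_ideal U))"
proof -
  have mult: "F * G \<in> rees (exponent_ideal U)"
    if F: "F \<in> rees (exponent_ideal U)" and G: "G \<in> rees (exponent_ideal U)" for F G
    unfolding rees_iff[OF U]
  proof safe
    fix i a b assume "coeff3 (F * G) i a b \<noteq> 0"
    then show "(a, b) \<in> npow U i"
    proof (rule coeff3_mult_nonzeroE)
      fix h c d i' c' d'
      assume *: "i = h + i'" "a = c + c'" "b = d + d'" "coeff3 F h c d \<noteq> 0" "coeff3 G i' c' d' \<noteq> 0"
      then have "(c, d) + (c', d') \<in> npow U h + npow U i'"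
        using F G unfolding rees_iff[OF U] by (intro set_plus_intro) auto
      then show "(a, b) \<in> npow U i" by (simp add: * npow_add[OF U])
    qed
  qed
  have add: "F + G \<in> rees (exponent_ideal U)"
    if "F \<in> rees (exponent_ideal U)" "G \<in> rees (exponent_ideal U)" for F G
    using that unfolding rees_iff[OF U] by force
  have neg: "- F \<in> rees (exponent_ideal U)" if "F \<in> rees (exponent_ideal U)" for F
    using that unfolding rees_iff[OF U] by simp
  have "1 \<in> rees (exponent_ideal U)" unfolding rees_iff[OF U] by simp
  then show ?thesis
    unfolding is_subring_def using mult add neg by simp
qed

definition rees_monom :: "nat \<Rightarrow> nat \<Rightarrow> nat \<Rightarrow> poly2 Polynomial.poly" where
  "rees_monom i a b = Polynomial.monom (xy_monom a b) i"

lemma coeff3_rees_monom: "coeff3 (rees_monom i a b) j c d = (if j = i \<and> c = a \<and> d = b then 1 else 0)"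
  by (simp add: rees_monom_def coeff2_xy_monom)

lemma rees_monom_in_rees:
  "up_closed U \<Longrightarrow> rees_monom i a b \<in> rees (exponent_ideal U) \<longleftrightarrow> (a, b) \<in> npow U i"
  by (auto simp: rees_iff coeff3_rees_monom)

lemma rees_monom_mult: "rees_monom i a b * rees_monom j c d = rees_monom (i + j) (a + c) (b + d)"
  by (simp add: rees_monom_def mult_monom xy_monom_mult)

lemma rees_monom_0: "rees_monom 0 0 0 = 1"
  by (simp add: rees_monom_def xy_monom_0)

lemma rees_monom_power: "rees_monom i a b ^ n = rees_monom (n * i) (n * a) (n * b)"
  by (induction n) (simp_all add: rees_monom_0 rees_monom_mult)

lemma constant_in_rees:
  assumes "up_closed U" shows "[:f:] \<in> rees (exponent_ideal U)"
  unfolding rees_iff[OF assms] 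
  by (auto simp: coeff3_def Polynomial.coeff_pCons split: nat.splits)

lemma rees_ideal_mem_if_monoms:
  assumes U: "up_closed U"
    and P: "ideal P (rees_ring (exponent_ideal U))"
    and F: "\<And>i a b. coeff3 F i a b \<noteq> 0 \<Longrightarrow> rees_monom i a b \<in> P"
  shows "F \<in> P"
proof -
  have P': "0 \<in> P" "\<And>f g. f \<in> P \<Longrightarrow> g \<in> P \<Longrightarrow> f + g \<in> P"
    "\<And>r f. r \<in> rees (exponent_ideal U) \<Longrightarrow> f \<in> P \<Longrightarrow> r * f \<in> P"
    using P unfolding ideal_subring_iff[OF is_subring_rees[OF U]] by blast+
  have sum: "sum f A \<in> P" if "\<And>x. x \<in> A \<Longrightarrow> f x \<in> P" for A :: "nat set" and f
    using that P' by (induction A rule: infinite_finite_induct) auto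
  have "Polynomial.monom (Polynomial.coeff F i) i \<in> P" for i
  proof -
    let ?I = "{f. Polynomial.monom f i \<in> P}"
    have "Polynomial.monom (r * f) i \<in> P" if "Polynomial.monom f i \<in> P" for r f
    proof -
      have "[:r:] * Polynomial.monom f i \<in> P"
        using P'(3)[OF constant_in_rees[OF U] that] .
      then show ?thesis by (simp add: smult_monom)
    qed
    then have "ideal ?I Cxy"
      using P'(1,2) unfolding Cxy_ideal_iff by (auto simp: add_monom[symmetric])
    then have "Polynomial.coeff F i \<in> ?I"
      by (rule ideal_mem_if_monoms) (use F in \<open>simp add: coeff3_def rees_monom_def\<close>)
    then show ?thesis by simp
  qed
  then have "(\<Sum>i\<le>Polynomial.degree F. Polynomial.monom (Polynomial.coeff F i) i) \<in> P"
    by (intro sum)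
  then show ?thesis by (simp only: poly_as_sum_of_monoms)
qed

section \<open>The centre of a monomial valuation\<close>

text \<open>The grading of \<open>\<complex>[x,y,t]\<close> in which \<open>x\<close>, \<open>y\<close>, \<open>t\<close> have degrees \<open>\<beta>\<close>, \<open>\<alpha>\<close>, \<open>-m\<close>. If \<open>m\<close> is a lower bound of
  the valuation on the ideal, the Rees algebra lives in nonnegative degrees.\<close>

definition weight :: "nat \<Rightarrow> nat \<Rightarrow> nat \<Rightarrow> nat \<Rightarrow> nat \<Rightarrow> nat \<Rightarrow> int" where
  "weight \<alpha> \<beta> m i a b = int (\<beta> * a + \<alpha> * b) - int (m * i)"

lemma weight_add: "weight \<alpha> \<beta> m (i + j) (a + c) (b + d) = weight \<alpha> \<beta> m i a b + weight \<alpha> \<beta> m j c d"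
  by (simp add: weight_def algebra_simps)

definition poly_filter :: "(nat \<Rightarrow> 'a::zero \<Rightarrow> 'b::zero) \<Rightarrow> 'a Polynomial.poly \<Rightarrow> 'b Polynomial.poly" where
  "poly_filter h p = Abs_poly (\<lambda>n. h n (Polynomial.coeff p n))"

lemma coeff_poly_filter:
  assumes "\<And>n. h n 0 = 0"
  shows "Polynomial.coeff (poly_filter h p) n = h n (Polynomial.coeff p n)"
  unfolding poly_filter_def
  by (subst coeff_Abs_poly[of "Polynomial.degree p"]) (simp_all add: assms Polynomial.coeff_eq_0)

lemma poly_filter_0: "(\<And>n. h n 0 = 0) \<Longrightarrow> poly_filter h 0 = 0"
  by (intro poly_eqI) (simp add: coeff_poly_filter)

text \<open>The component of degree \<open>0\<close> for \<open>weight\<close>. On polynomials in nonnegative degrees it is a ring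
  homomorphism into a domain, with kernel the polynomials in positive degrees; this is why the
  centre of the valuation is prime.\<close>

definition initial_form :: "nat \<Rightarrow> nat \<Rightarrow> nat \<Rightarrow> poly2 Polynomial.poly \<Rightarrow> poly2 Polynomial.poly" where
  "initial_form \<alpha> \<beta> m = poly_filter (\<lambda>i. poly_filter (\<lambda>b. poly_filter (\<lambda>a c.
     if weight \<alpha> \<beta> m i a b = 0 then c else 0)))"

lemma coeff3_initial_form:
  "coeff3 (initial_form \<alpha> \<beta> m F) i a b = (if weight \<alpha> \<beta> m i a b = 0 then coeff3 F i a b else 0)"
  by (simp add: coeff3_def coeff2_def initial_form_def coeff_poly_filter poly_filter_0)

text \<open>A sum of two nonnegative weights vanishes only if both vanish.\<close>

lemma initial_form_mult:
  assumes F: "\<And>i a b. coeff3 F i a b \<noteq> 0 \<Longrightarrow> weight \<alpha> \<beta> m i a b \<ge> 0"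
    and G: "\<And>i a b. coeff3 G i a b \<noteq> 0 \<Longrightarrow> weight \<alpha> \<beta> m i a b \<ge> 0"
  shows "initial_form \<alpha> \<beta> m (F * G) = initial_form \<alpha> \<beta> m F * initial_form \<alpha> \<beta> m G"
proof (rule coeff3_eqI)
  fix i a b
  let ?w = "weight \<alpha> \<beta> m"
  have "(if ?w i a b = 0 then coeff3 F h c d * coeff3 G (i - h) (a - c) (b - d) else 0)
    = coeff3 (initial_form \<alpha> \<beta> m F) h c d * coeff3 (initial_form \<alpha> \<beta> m G) (i - h) (a - c) (b - d)"
    if "h \<le> i" "d \<le> b" "c \<le> a" for h c d
  proof -
    have "?w i a b = ?w h c d + ?w (i - h) (a - c) (b - d)"
      using that weight_add[of \<alpha> \<beta> m h "i - h" c "a - c" d "b - d"] by simp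
    then show ?thesis
      using F[of h c d] G[of "i - h" "a - c" "b - d"]
      by (cases "coeff3 F h c d = 0"; cases "coeff3 G (i - h) (a - c) (b - d) = 0")
        (auto simp: coeff3_initial_form)
  qed
  then have "(\<Sum>h\<le>i. \<Sum>d\<le>b. \<Sum>c\<le>a. if ?w i a b = 0 then coeff3 F h c d * coeff3 G (i - h) (a - c) (b - d) else 0)
    = coeff3 (initial_form \<alpha> \<beta> m F * initial_form \<alpha> \<beta> m G) i a b"
    unfolding coeff3_mult by (intro sum.cong refl) auto
  then show "coeff3 (initial_form \<alpha> \<beta> m (F * G)) i a b
    = coeff3 (initial_form \<alpha> \<beta> m F * initial_form \<alpha> \<beta> m G) i a b"
    by (cases "?w i a b = 0") (simp_all add: coeff3_initial_form[of \<alpha> \<beta> m "F * G"] coeff3_mult[of F G])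
qed

text \<open>The centre on the blowup of \<open>J\<close> of the monomial valuation with values \<open>\<beta>\<close> on \<open>x\<close> and \<open>\<alpha>\<close> on \<open>y\<close>, provided
  that \<open>m\<close> is its minimum on \<open>J\<close>.\<close>

definition center :: "nat \<Rightarrow> nat \<Rightarrow> nat \<Rightarrow> poly2 set \<Rightarrow> poly2 Polynomial.poly set" where
  "center \<alpha> \<beta> m J = {F \<in> rees J. \<forall>i a b. coeff3 F i a b \<noteq> 0 \<longrightarrow> weight \<alpha> \<beta> m i a b > 0}"

text \<open>A linear lower bound on a set of exponents scales with Minkowski powers.\<close>

lemma weight_npow_nonneg:
  assumes lower: "\<And>a b. (a, b) \<in> U \<Longrightarrow> m \<le> \<beta> * a + \<alpha> * b" and "(a, b) \<in> npow U i"
  shows "weight \<alpha> \<beta> m i a b \<ge> 0"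
  using assms(2)
proof (induction i arbitrary: a b)
  case (Suc i)
  from Suc.prems obtain c d e g where *: "a = c + e" "b = d + g" "(c, d) \<in> npow U i" "(e, g) \<in> U"
    by (auto elim: exponent_plusE)
  have "weight \<alpha> \<beta> m (i + 1) (c + e) (d + g) \<ge> 0"
    unfolding weight_add using Suc.IH[OF *(3)] lower[OF *(4)] by (simp add: weight_def flip: of_nat_mult of_nat_add)
  then show ?case by (simp add: *)
qed (simp add: weight_def)

lemma primeideal_center:
  assumes U: "up_closed U" and lower: "\<And>a b. (a, b) \<in> U \<Longrightarrow> m \<le> \<beta> * a + \<alpha> * b"
  shows "primeideal (center \<alpha> \<beta> m (exponent_ideal U)) (rees_ring (exponent_ideal U))"
proof -
  let ?R = "rees (exponent_ideal U)" and ?P = "center \<alpha> \<beta> m (exponent_ideal U)"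
  have nonneg: "weight \<alpha> \<beta> m i a b \<ge> 0" if "F \<in> ?R" "coeff3 F i a b \<noteq> 0" for F i a b
    using that weight_npow_nonneg[of U m \<beta> \<alpha> a b i] lower unfolding rees_iff[OF U] by blast
  have P_iff: "F \<in> ?P \<longleftrightarrow> F \<in> ?R \<and> initial_form \<alpha> \<beta> m F = 0" for F
  proof -
    have "initial_form \<alpha> \<beta> m F = 0 \<longleftrightarrow> (\<forall>i a b. coeff3 (initial_form \<alpha> \<beta> m F) i a b = 0)"
      by (metis coeff3_eqI coeff3_simps(1))
    also have "\<dots> \<longleftrightarrow> (\<forall>i a b. coeff3 F i a b \<noteq> 0 \<longrightarrow> weight \<alpha> \<beta> m i a b \<noteq> 0)"
      by (auto simp: coeff3_initial_form)
    finally show ?thesis using nonneg by (force simp: center_def less_le)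
  qed
  have mult: "initial_form \<alpha> \<beta> m (F * G) = initial_form \<alpha> \<beta> m F * initial_form \<alpha> \<beta> m G"
    if "F \<in> ?R" "G \<in> ?R" for F G
    using nonneg that by (intro initial_form_mult) auto
  have add: "initial_form \<alpha> \<beta> m (F + G) = initial_form \<alpha> \<beta> m F + initial_form \<alpha> \<beta> m G" for F G
    by (rule coeff3_eqI) (simp add: coeff3_initial_form)
  have "initial_form \<alpha> \<beta> m 0 = 0" by (rule coeff3_eqI) (simp add: coeff3_initial_form)
  moreover have "initial_form \<alpha> \<beta> m 1 = 1"
    by (rule coeff3_eqI) (simp add: coeff3_initial_form weight_def)
  moreover have "0 \<in> ?R" by (simp add: rees_iff[OF U])
  ultimately show ?thesis
    using is_subring_rees[OF U] unfolding primeideal_subring_iff[OF is_subring_rees[OF U]]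
    by (simp add: P_iff mult add subset_eq is_subring_def)
qed

lemma rees_monom_in_center:
  "up_closed U \<Longrightarrow> rees_monom i a b \<in> center \<alpha> \<beta> m (exponent_ideal U)
     \<longleftrightarrow> (a, b) \<in> npow U i \<and> weight \<alpha> \<beta> m i a b > 0"
  by (auto simp: center_def rees_monom_in_rees coeff3_rees_monom)

lemma homogeneous_center:
  assumes "up_closed U" shows "homogeneous (center \<alpha> \<beta> m (exponent_ideal U))"
  unfolding homogeneous_def center_def 
  by (auto simp: rees_iff[OF assms] coeff3_def[symmetric])

lemma blowup_map_prime:
  assumes U: "up_closed U" and P: "primeideal P (rees_ring (exponent_ideal U))"
  shows "primeideal (blowup_map P) Cxy"
proof -
  have mult: "[:f * g:] = [:f:] * [:g:]" for f g :: poly2 by simp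
  have add: "[:f + g:] = [:f:] + [:g:]" for f g :: poly2 by simp
  have const: "[:1:] = (1 :: poly2 Polynomial.poly)" "[:0:] = (0 :: poly2 Polynomial.poly)" by simp_all
  have P': "0 \<in> P" "1 \<notin> P" "\<And>f g. f \<in> P \<Longrightarrow> g \<in> P \<Longrightarrow> f + g \<in> P"
    "\<And>r f. r \<in> rees (exponent_ideal U) \<Longrightarrow> f \<in> P \<Longrightarrow> r * f \<in> P"
    "\<And>f g. f \<in> rees (exponent_ideal U) \<Longrightarrow> g \<in> rees (exponent_ideal U) \<Longrightarrow> f * g \<in> P \<Longrightarrow> f \<in> P \<or> g \<in> P"
    using P unfolding primeideal_subring_iff[OF is_subring_rees[OF U]] by blast+
  show ?thesis
    unfolding Cxy_primeideal_iff blowup_map_def mem_Collect_eq mult add const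
    using P'(1,2,3) P'(4)[OF constant_in_rees[OF U]] P'(5)[OF constant_in_rees[OF U] constant_in_rees[OF U]]
    by blast
qed

section \<open>Components and edges of the Newton polygon\<close>

text \<open>The minimum of the linear form \<open>(a, b) \<mapsto> B a + A b\<close> on the Minkowski sum of the segments from
  \<open>(\<delta>\<^sub>l\<alpha>\<^sub>l, 0)\<close> to \<open>(0, \<delta>\<^sub>l\<beta>\<^sub>l)\<close>, which is the sum of the minima at the ends of the segments.\<close>

definition support_min ::
  "('k \<Rightarrow> nat) \<Rightarrow> ('k \<Rightarrow> nat) \<Rightarrow> ('k \<Rightarrow> nat) \<Rightarrow> 'k set \<Rightarrow> nat \<Rightarrow> nat \<Rightarrow> nat" where
  "support_min \<alpha> \<beta> \<delta> K A B = (\<Sum>l\<in>K. \<delta> l * min (B * \<alpha> l) (A * \<beta> l))"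

text \<open>Fractional knapsack. Each item \<open>l\<close> can be moved from \<open>(0, \<delta>\<^sub>l\<beta>\<^sub>l)\<close> to \<open>(\<delta>\<^sub>l\<alpha>\<^sub>l, 0)\<close>, gaining \<open>\<delta>\<^sub>l\<beta>\<^sub>l\<close> in \<open>y\<close> at
  the price \<open>\<delta>\<^sub>l\<alpha>\<^sub>l\<close> in \<open>x\<close>. With a budget \<open>a\<close> one moves the items in increasing order of \<open>\<alpha>\<^sub>l / \<beta>\<^sub>l\<close>: either
  all items can be moved or there is a critical item \<open>k\<close> at which the budget is exhausted.
  Geometrically, \<open>k\<close> is the edge of the polygon below the points with first coordinate \<open>a\<close>.\<close>

lemma greedy_split:
  fixes \<alpha> \<beta> \<delta> :: "'k \<Rightarrow> nat"
  assumes "finite K" "\<And>k. k \<in> K \<Longrightarrow> \<beta> k > 0"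
  shows "(\<Sum>l\<in>K. \<delta> l * \<alpha> l) \<le> a \<or>
    (\<exists>S\<subseteq>K. \<exists>k\<in>K - S. (\<Sum>l\<in>S. \<delta> l * \<alpha> l) \<le> a \<and> a < (\<Sum>l\<in>S. \<delta> l * \<alpha> l) + \<delta> k * \<alpha> k \<and>
       (\<forall>l\<in>S. \<beta> k * \<alpha> l \<le> \<alpha> k * \<beta> l) \<and> (\<forall>l\<in>K - S. \<alpha> k * \<beta> l \<le> \<beta> k * \<alpha> l))"
  (is "?full K \<or> (\<exists>S\<subseteq>K. \<exists>k\<in>K - S. ?split K S k)")
  using assms
proof (induction K rule: finite_ranking_induct[where f = "\<lambda>k. real (\<alpha> k) / real (\<beta> k)"])
  case empty
  then show ?case by simp
next
  case (insert x K)
  show ?case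
  proof (cases "x \<in> K")
    case True
    then show ?thesis using insert.IH insert.prems by (simp add: insert_absorb)
  next
    case x: False
    have flat: "\<alpha> k * \<beta> x \<le> \<beta> k * \<alpha> x" if "k \<in> K" for k
    proof -
      have "real (\<alpha> k) / real (\<beta> k) \<le> real (\<alpha> x) / real (\<beta> x)" using insert that by blast
      moreover have "\<beta> k > 0" "\<beta> x > 0" using insert.prems that by auto
      ultimately have "real (\<alpha> k * \<beta> x) \<le> real (\<beta> k * \<alpha> x)" by (simp add: field_simps)
      then show ?thesis by linarith
    qed
    from insert.IH insert.prems consider "?full K" | S k where "S \<subseteq> K" "k \<in> K - S" "?split K S k" by blast
    then show ?thesis
    proof cases
      case 1
      show ?thesis
      proof (cases "?full (insert x K)")
        case False
        have "?split (insert x K) K x" 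
          using 1 False x insert.hyps flat by (auto simp: mult.commute add.commute)
        then show ?thesis using x by blast
      qed simp
    next
      case 2
      then have "?split (insert x K) S k" "S \<subseteq> insert x K" "k \<in> insert x K - S" using flat x by auto
      then show ?thesis by blast
    qed
  qed
qed

text \<open>The convex hull of \<open>U\<close> is the Minkowski sum of the segments from \<open>(\<delta>\<^sub>l\<alpha>\<^sub>l, 0)\<close> to \<open>(0, \<delta>\<^sub>l\<beta>\<^sub>l)\<close>, up to the
  positive quadrant. The inclusion of \<open>U\<close> is expressed through the supporting lines of the edges, the
  reverse inclusion through the sums of ends of the segments, among which are all vertices. Only powers
  of the latter have to lie in powers of the ideal, so that the locale covers a monomial ideal as well
  as its normalisation.\<close>

locale newton_edges =
  fixes U :: "(nat \<times> nat) set" and K :: "'k set" and \<alpha> \<beta> \<delta> :: "'k \<Rightarrow> nat"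
  assumes up_closed: "up_closed U"
    and finite_K: "finite K"
    and positive: "\<And>k. k \<in> K \<Longrightarrow> \<alpha> k > 0 \<and> \<beta> k > 0 \<and> \<delta> k > 0"
    and coprime_edge: "\<And>k. k \<in> K \<Longrightarrow> coprime (\<alpha> k) (\<beta> k)"
    and distinct_edges: "inj_on (\<lambda>k. (\<alpha> k, \<beta> k)) K"
    and support_bound: "\<And>a b k. (a, b) \<in> U \<Longrightarrow> k \<in> K \<Longrightarrow>
          support_min \<alpha> \<beta> \<delta> K (\<alpha> k) (\<beta> k) \<le> \<beta> k * a + \<alpha> k * b"
    and partial_sums: "\<And>S. S \<subseteq> K \<Longrightarrow> 
          ((\<Sum>l\<in>S. \<delta> l * \<alpha> l), (\<Sum>l\<in>K - S. \<delta> l * \<beta> l)) \<in> npow_closure U"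
begin

definition J :: "poly2 set" where "J = exponent_ideal U"

definition m :: "'k \<Rightarrow> nat" where "m k = support_min \<alpha> \<beta> \<delta> K (\<alpha> k) (\<beta> k)"

definition xsum :: "'k set \<Rightarrow> nat" where "xsum S = (\<Sum>l\<in>S. \<delta> l * \<alpha> l)"

definition ysum :: "'k set \<Rightarrow> nat" where "ysum S = (\<Sum>l\<in>K - S. \<delta> l * \<beta> l)"

definition generic_point :: "'k \<Rightarrow> poly2 Polynomial.poly set" where
  "generic_point k = center (\<alpha> k) (\<beta> k) (m k) J"

lemma partial_sumsE:
  assumes "S \<subseteq> K"
  obtains p where "p \<ge> 1" "(p * xsum S, p * ysum S) \<in> npow U p"
  using partial_sums[OF assms] by (auto simp: npow_closure_def xsum_def ysum_def)

lemma weight_partial_sum: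
  assumes "S \<subseteq> K"
  shows "\<beta> k * xsum S + \<alpha> k * ysum S = (\<Sum>l\<in>K. \<delta> l * (if l \<in> S then \<beta> k * \<alpha> l else \<alpha> k * \<beta> l))"
proof -
  have "(\<Sum>l\<in>K. \<delta> l * (if l \<in> S then \<beta> k * \<alpha> l else \<alpha> k * \<beta> l))
    = (\<Sum>l\<in>S. \<delta> l * (\<beta> k * \<alpha> l)) + (\<Sum>l\<in>K - S. \<delta> l * (\<alpha> k * \<beta> l))"
    by (subst sum.subset_diff[OF assms finite_K]) (simp add: add.commute)
  then show ?thesis
    by (simp add: xsum_def ysum_def sum_distrib_left algebra_simps)
qed

lemma min_weight_le_weight_partial_sum: "S \<subseteq> K \<Longrightarrow> m k \<le> \<beta> k * xsum S + \<alpha> k * ysum S"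
  unfolding weight_partial_sum m_def support_min_def by (intro sum_mono mult_left_mono) auto

lemma weight_partial_sum_eq_min_weight:
  assumes "S \<subseteq> K" "\<And>l. l \<in> S \<Longrightarrow> \<beta> k * \<alpha> l \<le> \<alpha> k * \<beta> l" "\<And>l. l \<in> K - S \<Longrightarrow> \<alpha> k * \<beta> l \<le> \<beta> k * \<alpha> l"
  shows "\<beta> k * xsum S + \<alpha> k * ysum S = m k"
  unfolding weight_partial_sum[OF assms(1)] m_def support_min_def
  using assms by (intro sum.cong refl) auto

lemma m_pos: "k \<in> K \<Longrightarrow> m k > 0"
  unfolding m_def support_min_def using positive finite_K by (intro sum_pos2[of _ k]) auto

lemma xsum_insert: "S \<subseteq> K \<Longrightarrow> k \<in> K - S \<Longrightarrow> xsum (insert k S) = xsum S + \<delta> k * \<alpha> k"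
  using finite_subset[OF _ finite_K, of S] by (simp add: xsum_def)

lemma ysum_insert: "k \<in> K - S \<Longrightarrow> ysum S = ysum (insert k S) + \<delta> k * \<beta> k"
  using finite_K by (simp add: ysum_def sum.remove[of "K - S" k] Diff_insert[symmetric] del: Diff_insert0)

text \<open>The convex hull is cut out by the supporting lines of its compact edges. If \<open>(a, b)\<close> lies above the
  edge \<open>k\<close> that the knapsack argument finds, it dominates a convex combination of the two ends of
  that edge, and some powers of the monomials at the ends lie in powers of the ideal.\<close>

lemma power_in_npow:
  assumes ab: "\<And>k. k \<in> K \<Longrightarrow> n * m k \<le> \<beta> k * a + \<alpha> k * b"
  shows "\<exists>p\<ge>1. (p * a, p * b) \<in> npow U (p * n)"
proof -
  have "n * xsum K \<le> a \<or> (\<exists>S\<subseteq>K. \<exists>k\<in>K - S. n * xsum S \<le> a \<and> a < n * xsum S + n * \<delta> k * \<alpha> k \<and>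
       (\<forall>l\<in>S. \<beta> k * \<alpha> l \<le> \<alpha> k * \<beta> l) \<and> (\<forall>l\<in>K - S. \<alpha> k * \<beta> l \<le> \<beta> k * \<alpha> l))"
    using greedy_split[of K \<beta> "\<lambda>l. n * \<delta> l" \<alpha> a] finite_K positive 
    by (simp add: xsum_def sum_distrib_left mult.assoc)
  then consider "n * xsum K \<le> a" | S k where "S \<subseteq> K" "k \<in> K - S" "n * xsum S \<le> a" "a < n * xsum S + n * \<delta> k * \<alpha> k"
       "\<forall>l\<in>S. \<beta> k * \<alpha> l \<le> \<alpha> k * \<beta> l" "\<forall>l\<in>K - S. \<alpha> k * \<beta> l \<le> \<beta> k * \<alpha> l" by blast
  then show ?thesis
  proof cases
    case 1
    obtain p where p: "p \<ge> 1" "(p * xsum K, p * ysum K) \<in> npow U p" using partial_sumsE[of K] by blast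
    then have "(n * (p * xsum K), n * (p * ysum K)) \<in> npow U (n * p)" by (intro npow_scale up_closed)
    then have "(p * a, p * b) \<in> npow U (n * p)"
      by (rule up_closedD[OF up_closed_npow[OF up_closed]]) (use 1 in \<open>simp_all add: ysum_def\<close>)
    then show ?thesis using p(1) by (auto simp: mult.commute)
  next
    case 2
    (* The ends of the critical edge are (x + D A, y) and (x, y + D B). The exponent (a, b) dominates
       n times their convex combination with the weights c / (c + e) and e / (c + e); here c is the
       part of the budget left for the critical item. *)
    define A B D x y where defs: "A = \<alpha> k" "B = \<beta> k" "D = \<delta> k" "x = xsum S" "y = ysum (insert k S)"
    obtain c where c: "a = n * x + c" using 2(3) defs by (metis le_Suc_ex)
    have "c < n * D * A" using 2(4) c defs by simp
    then obtain e where e: "n * D * A = c + e" "e > 0" by (metis less_imp_add_positive)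
    have "ysum S = y + D * B" "xsum (insert k S) = x + D * A"
      using xsum_insert[OF 2(1,2)] ysum_insert[OF 2(2)] defs by simp_all
    note XY = this
    have "B * x + A * (y + D * B) = m k"
      using weight_partial_sum_eq_min_weight[of S k] 2 XY defs by simp
    then have "n * (B * x + A * (y + D * B)) \<le> B * (n * x + c) + A * b"
      using ab[of k] 2(2) c defs by simp
    then have "n * A * (y + D * B) \<le> B * c + A * b" by (simp add: algebra_simps)
    then have "(n * D) * (n * A * (y + D * B)) \<le> (n * D) * (B * c + A * b)" by (rule mult_le_mono2)
    moreover have "(n * D) * (n * A * (y + D * B)) = (c + e) * (n * (y + D * B))"
      by (simp add: e(1)[symmetric] algebra_simps)
    moreover have "(n * D) * (B * c + A * b) = n * D * B * c + (c + e) * b"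
      by (simp add: e(1)[symmetric] algebra_simps)
    ultimately have yb: "c * n * y + e * n * (y + D * B) \<le> (c + e) * b"
      by (simp add: algebra_simps)
    have "(c + e) * a = (c + e) * n * x + c * (n * D * A)"
      unfolding c e(1) by (simp add: algebra_simps)
    then have xa: "c * n * (x + D * A) + e * n * x = (c + e) * a"
      by (simp add: algebra_simps)
    obtain p where p: "p \<ge> 1" "(p * x, p * (y + D * B)) \<in> npow U p"
      using partial_sumsE[of S] 2(1) XY defs by metis
    obtain q where q: "q \<ge> 1" "(q * (x + D * A), q * y) \<in> npow U q"
      using partial_sumsE[of "insert k S"] 2(1,2) XY defs by (metis DiffD1 insert_subsetI)
    have "(c * n * p * (q * (x + D * A)), c * n * p * (q * y)) \<in> npow U (c * n * p * q)"
      and "(e * n * q * (p * x), e * n * q * (p * (y + D * B))) \<in> npow U (e * n * q * p)"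
      using npow_scale[OF up_closed] p q by blast+
    then have "(c * n * p * (q * (x + D * A)), c * n * p * (q * y)) + (e * n * q * (p * x), e * n * q * (p * (y + D * B)))
       \<in> npow U (c * n * p * q + e * n * q * p)"
      unfolding npow_add[OF up_closed] by (rule set_plus_intro)
    then have "(c * n * p * (q * (x + D * A)) + e * n * q * (p * x), c * n * p * (q * y) + e * n * q * (p * (y + D * B)))
       \<in> npow U (c * n * p * q + e * n * q * p)" by simp
    moreover have "c * n * p * (q * (x + D * A)) + e * n * q * (p * x) = p * q * (c * n * (x + D * A) + e * n * x)"
      by (simp add: algebra_simps)
    moreover have "c * n * p * (q * y) + e * n * q * (p * (y + D * B)) = p * q * (c * n * y + e * n * (y + D * B))"
      by (simp add: algebra_simps)
    moreover have "c * n * p * q + e * n * q * p = p * q * (c + e) * n" by (simp add: algebra_simps)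
    ultimately have "(p * q * ((c + e) * a), p * q * (c * n * y + e * n * (y + D * B))) \<in> npow U (p * q * (c + e) * n)"
      using xa by simp
    then have "(p * q * ((c + e) * a), p * q * ((c + e) * b)) \<in> npow U (p * q * (c + e) * n)"
      by (rule up_closedD[OF up_closed_npow[OF up_closed]]) (use yb in simp_all)
    moreover have "p * q * (c + e) \<ge> 1" using p q e by simp
    ultimately show ?thesis by (metis mult.assoc)
  qed
qed

text \<open>Both ends of the edge \<open>k\<close> have minimal weight: for items \<open>l\<close> with a steeper segment the end on the
  \<open>x\<close>-axis is optimal, for those with a flatter one the end on the \<open>y\<close>-axis, and for \<open>k\<close> itself
  both choices are optimal.\<close>

lemma partial_sum_at_edge:
  assumes "k \<in> K"
  obtains S where "S \<subseteq> K - {k}" "\<beta> k * xsum S + \<alpha> k * ysum S = m k"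
    "\<beta> k * xsum (insert k S) + \<alpha> k * ysum (insert k S) = m k"
proof
  define S where "S = {l \<in> K - {k}. \<beta> k * \<alpha> l \<le> \<alpha> k * \<beta> l}"
  show "S \<subseteq> K - {k}" by (auto simp: S_def)
  show "\<beta> k * xsum S + \<alpha> k * ysum S = m k" "\<beta> k * xsum (insert k S) + \<alpha> k * ysum (insert k S) = m k"
    by (rule weight_partial_sum_eq_min_weight; use assms in \<open>auto simp: S_def\<close>)+
qed

lemma proportional_edges_eq:
  assumes "k \<in> K" "l \<in> K" "\<beta> k * \<alpha> l = \<alpha> k * \<beta> l"
  shows "k = l"
proof -
  have "\<alpha> k dvd \<alpha> l" using coprime_edge[OF assms(1)] assms(3)
    by (metis coprime_dvd_mult_right_iff dvd_triv_left)
  moreover have "\<alpha> l dvd \<alpha> k" using coprime_edge[OF assms(2)] assms(3)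
    by (metis coprime_dvd_mult_left_iff dvd_triv_right)
  ultimately have "\<alpha> k = \<alpha> l" by (rule dvd_antisym)
  moreover from this have "\<beta> k = \<beta> l" using assms positive[of k] by simp
  ultimately show ?thesis using distinct_edges assms(1,2) by (auto dest: inj_onD)
qed

text \<open>If both ends of the edge \<open>l\<close> had minimal weight for \<open>k\<close>, both edges would have the same direction,
  but distinct indices have distinct primitive directions.\<close>

lemma separating_partial_sum:
  assumes "k \<in> K" "l \<in> K" "k \<noteq> l"
  obtains S where "S \<subseteq> K" "\<beta> l * xsum S + \<alpha> l * ysum S = m l" "\<beta> k * xsum S + \<alpha> k * ysum S > m k"
proof -
  obtain S where S: "S \<subseteq> K - {l}" "\<beta> l * xsum S + \<alpha> l * ysum S = m l"
    "\<beta> l * xsum (insert l S) + \<alpha> l * ysum (insert l S) = m l"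
    using partial_sum_at_edge[OF assms(2)] by blast
  have "xsum (insert l S) = xsum S + \<delta> l * \<alpha> l" "ysum S = ysum (insert l S) + \<delta> l * \<beta> l"
    using S(1) assms(2) by (auto intro!: xsum_insert ysum_insert)
  moreover have "\<delta> l * (\<beta> k * \<alpha> l) \<noteq> \<delta> l * (\<alpha> k * \<beta> l)"
    using proportional_edges_eq assms positive by fastforce
  ultimately have "\<beta> k * xsum S + \<alpha> k * ysum S \<noteq> \<beta> k * xsum (insert l S) + \<alpha> k * ysum (insert l S)"
    by (simp add: algebra_simps)
  moreover have "S \<subseteq> K" "insert l S \<subseteq> K" using S(1) assms by auto
  ultimately show ?thesis
    using that[of S] that[of "insert l S"] S min_weight_le_weight_partial_sum[of S k]
      min_weight_le_weight_partial_sum[of "insert l S" k] by linarith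
qed

lemma weight_scaled_partial_sum:
  "weight (\<alpha> k) (\<beta> k) (m k) p (p * xsum S) (p * ysum S) = int p * (int (\<beta> k * xsum S + \<alpha> k * ysum S) - int (m k))"
  by (simp add: weight_def algebra_simps)

text \<open>A vertex on the edge \<open>l\<close> but not on the edge \<open>k\<close> has a power that gives a monomial of the Rees
  algebra in the centre of the valuation of \<open>k\<close> but not in that of \<open>l\<close>.\<close>

lemma generic_point_incomparable:
  assumes "k \<in> K" "l \<in> K" "generic_point k \<subseteq> generic_point l"
  shows "k = l"
proof (rule ccontr)
  assume "k \<noteq> l"
  then obtain S where S: "S \<subseteq> K" "\<beta> l * xsum S + \<alpha> l * ysum S = m l" "\<beta> k * xsum S + \<alpha> k * ysum S > m k"
    using separating_partial_sum assms by blast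
  obtain p where p: "p \<ge> 1" "(p * xsum S, p * ysum S) \<in> npow U p" using partial_sumsE[OF S(1)] .
  have "rees_monom p (p * xsum S) (p * ysum S) \<in> generic_point k"
  proof -
    have "int (m k) < int (\<beta> k * xsum S + \<alpha> k * ysum S)" using S(3) by (simp only: of_nat_less_iff)
    then have "weight (\<alpha> k) (\<beta> k) (m k) p (p * xsum S) (p * ysum S) > 0"
      unfolding weight_scaled_partial_sum using p(1) by (intro mult_pos_pos) linarith+
    then show ?thesis
      using p(2) by (simp add: generic_point_def J_def rees_monom_in_center[OF up_closed])
  qed
  moreover have "rees_monom p (p * xsum S) (p * ysum S) \<notin> generic_point l"
    using S(2) by (simp only: generic_point_def J_def rees_monom_in_center[OF up_closed] weight_scaled_partial_sum) simp
  ultimately show False using assms(3) by blast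
qed

lemma prime_generic_point: "k \<in> K \<Longrightarrow> primeideal (generic_point k) (rees_ring J)"
  unfolding generic_point_def J_def m_def using up_closed support_bound by (intro primeideal_center) auto

definition exceptional_points :: "poly2 Polynomial.poly set set" where
  "exceptional_points = {P. homogeneous P \<and> \<not> irrelevant_ideal J \<subseteq> P} \<inter> {P. blowup_map P \<in> zero_locus Cxy J}"

lemma exceptional_divisor_J: "exceptional_divisor J = subtopology (Spec (rees_ring J)) exceptional_points"
  by (simp add: exceptional_divisor_def blowup_def subtopology_subtopology exceptional_points_def)

lemma generic_point_in_E:
  assumes k: "k \<in> K"
  shows "generic_point k \<in> exceptional_points"
proof -
  have "homogeneous (generic_point k)"
    unfolding generic_point_def J_def by (rule homogeneous_center[OF up_closed])
  moreover have "\<not> irrelevant_ideal J \<subseteq> generic_point k"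
  proof -
    obtain S where S: "S \<subseteq> K - {k}" "\<beta> k * xsum S + \<alpha> k * ysum S = m k" using partial_sum_at_edge[OF k] by blast
    obtain p where p: "p \<ge> 1" "(p * xsum S, p * ysum S) \<in> npow U p" using partial_sumsE[of S] S(1) by blast
    have "rees_monom p (p * xsum S) (p * ysum S) \<notin> generic_point k"
      using S(2) by (simp only: generic_point_def J_def rees_monom_in_center[OF up_closed] weight_scaled_partial_sum) simp
    moreover have "rees_monom p (p * xsum S) (p * ysum S) \<in> irrelevant_ideal J"
      using p by (simp add: irrelevant_ideal_def J_def rees_monom_in_rees[OF up_closed]) (simp add: rees_monom_def)
    ultimately show ?thesis by blast
  qed
  moreover have "primeideal (blowup_map (generic_point k)) Cxy"
    using blowup_map_prime[OF up_closed] prime_generic_point[OF k] by (simp add: J_def)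
  moreover have "J \<subseteq> blowup_map (generic_point k)"
  proof
    fix f assume f: "f \<in> J"
    have "weight (\<alpha> k) (\<beta> k) (m k) i a b > 0" if "coeff3 [:f:] i a b \<noteq> 0" for i a b
    proof -
      have i: "i = 0" "coeff2 f a b \<noteq> 0"
        using that by (auto simp: coeff3_def Polynomial.coeff_pCons split: nat.splits)
      have "m k \<le> \<beta> k * a + \<alpha> k * b"
        using support_bound[OF exponent_idealD[OF f[unfolded J_def] i(2)] k] by (simp add: m_def)
      then have "0 < \<beta> k * a + \<alpha> k * b" using m_pos[OF k] by linarith
      then show ?thesis unfolding weight_def i(1) by linarith
    qed
    then show "f \<in> blowup_map (generic_point k)"
      using constant_in_rees[OF up_closed] by (simp add: blowup_map_def generic_point_def center_def J_def)
  qed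
  ultimately show ?thesis by (simp add: exceptional_points_def zero_locus_def)
qed

lemma contains_generic_point:
  assumes P: "primeideal P (rees_ring J)" "P \<in> exceptional_points"
  shows "\<exists>k\<in>K. generic_point k \<subseteq> P"
proof (rule ccontr)
  assume none: "\<not> (\<exists>k\<in>K. generic_point k \<subseteq> P)"
  have ideal: "ideal P (rees_ring (exponent_ideal U))" 
    using primeideal.axioms(1)[OF P(1)] by (simp add: J_def)
  have one: "1 \<notin> P" and mult: "\<And>r f. r \<in> rees J \<Longrightarrow> f \<in> P \<Longrightarrow> r * f \<in> P"
    and prime: "\<And>f g. f \<in> rees J \<Longrightarrow> g \<in> rees J \<Longrightarrow> f * g \<in> P \<Longrightarrow> f \<in> P \<or> g \<in> P"
    using P(1) unfolding J_def primeideal_subring_iff[OF is_subring_rees[OF up_closed]] by blast+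
  have monom: "\<exists>i a b. rees_monom i a b \<in> rees J \<and> rees_monom i a b \<notin> P \<and> 
     weight (\<alpha> k) (\<beta> k) (m k) i a b > 0" if k: "k \<in> K" for k
  proof -
    obtain F where F: "F \<in> generic_point k" "F \<notin> P" using none k by blast
    then obtain i a b where iab: "coeff3 F i a b \<noteq> 0" "rees_monom i a b \<notin> P"
      using rees_ideal_mem_if_monoms[OF up_closed ideal] by blast
    then have "rees_monom i a b \<in> rees J" "weight (\<alpha> k) (\<beta> k) (m k) i a b > 0"
      using F(1) unfolding generic_point_def center_def J_def rees_monom_in_rees[OF up_closed]
      by (auto simp: rees_iff[OF up_closed])
    then show ?thesis using iab(2) by blast
  qed
  have nonneg: "weight (\<alpha> k) (\<beta> k) (m k) i a b \<ge> 0" if "rees_monom i a b \<in> rees J" "k \<in> K" for i a b k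
    by (rule weight_npow_nonneg[of U]) 
      (use that support_bound in \<open>auto simp: m_def J_def rees_monom_in_rees[OF up_closed]\<close>)
  have "\<exists>i a b. rees_monom i a b \<in> rees J \<and> rees_monom i a b \<notin> P \<and> 
     (\<forall>k\<in>L. weight (\<alpha> k) (\<beta> k) (m k) i a b > 0)" if "L \<subseteq> K" for L
    using finite_subset[OF that finite_K] that
  proof (induction L rule: finite_induct)
    case empty
    have "rees_monom 0 0 0 \<in> rees J" by (simp add: J_def rees_monom_in_rees[OF up_closed])
    moreover have "rees_monom 0 0 0 \<notin> P" using one by (simp add: rees_monom_0)
    ultimately show ?case by auto
  next
    case (insert k L)
    obtain i a b where 1: "rees_monom i a b \<in> rees J" "rees_monom i a b \<notin> P" 
      "\<forall>k\<in>L. weight (\<alpha> k) (\<beta> k) (m k) i a b > 0" using insert by blast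
    obtain j c d where 2: "rees_monom j c d \<in> rees J" "rees_monom j c d \<notin> P" 
      "weight (\<alpha> k) (\<beta> k) (m k) j c d > 0" using monom insert.prems by blast
    have "rees_monom (i + j) (a + c) (b + d) \<in> rees J"
      using is_subring_rees[OF up_closed] 1(1) 2(1) unfolding is_subring_def rees_monom_mult[symmetric] J_def by blast
    moreover have "rees_monom (i + j) (a + c) (b + d) \<notin> P"
      using prime 1(1,2) 2(1,2) unfolding rees_monom_mult[symmetric] by blast
    moreover have "weight (\<alpha> l) (\<beta> l) (m l) (i + j) (a + c) (b + d) > 0" if "l \<in> insert k L" for l
      unfolding weight_add
    proof (cases "l = k")
      case True
      then show "0 < weight (\<alpha> l) (\<beta> l) (m l) i a b + weight (\<alpha> l) (\<beta> l) (m l) j c d"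
        using 2(3) nonneg[OF 1(1), of k] insert.prems by simp
    next
      case False
      then have "l \<in> L" "l \<in> K" using that insert.prems by auto
      then show "0 < weight (\<alpha> l) (\<beta> l) (m l) i a b + weight (\<alpha> l) (\<beta> l) (m l) j c d"
        using 1(3) nonneg[OF 2(1), of l] by (simp add: add_pos_nonneg)
    qed
    ultimately show ?case by blast
  qed
  then obtain i a b where iab: "rees_monom i a b \<in> rees J" "rees_monom i a b \<notin> P"
    "\<And>k. k \<in> K \<Longrightarrow> weight (\<alpha> k) (\<beta> k) (m k) i a b > 0" by blast
  (* M bounds every minimum, so the excess of weight of the M-th power of the monomial pays for
     one more factor of the ideal: M * i + 1 instead of M * i. *)
  define M where "M = sum m K"
  have "(M * i + 1) * m k \<le> \<beta> k * (M * a) + \<alpha> k * (M * b)" if k: "k \<in> K" for k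
  proof -
    have "m k * i + 1 \<le> \<beta> k * a + \<alpha> k * b" using iab(3)[OF k] unfolding weight_def by linarith
    then have "M * (m k * i + 1) \<le> M * (\<beta> k * a + \<alpha> k * b)" by (rule mult_le_mono2)
    moreover have "m k \<le> M" unfolding M_def using finite_K k by (intro member_le_sum) auto
    ultimately show ?thesis by (simp add: algebra_simps)
  qed
  then obtain p where p: "p \<ge> 1" "(p * (M * a), p * (M * b)) \<in> npow U (p * (M * i + 1))"
    using power_in_npow by blast
  moreover have "Suc (p * M * i) \<le> p * (M * i + 1)" using p(1) by (simp add: algebra_simps)
  ultimately have "(p * M * a, p * M * b) \<in> npow U (Suc (p * M * i))"
    using npow_antimono[OF up_closed] by (metis mult.assoc subsetD)
  then obtain c d e g where cd: "p * M * a = c + e" "p * M * b = d + g" "(c, d) \<in> npow U (p * M * i)" "(e, g) \<in> U"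
    by (auto elim: exponent_plusE)
  have "xy_monom e g \<in> J" using cd(4) by (simp add: J_def)
  then have "rees_monom 0 e g \<in> P"
    using P(2) by (auto simp: exceptional_points_def zero_locus_def blowup_map_def rees_monom_def monom_0)
  moreover have "rees_monom (p * M * i) c d \<in> rees J" using cd(3) by (simp add: J_def rees_monom_in_rees[OF up_closed])
  ultimately have "rees_monom i a b ^ (p * M) \<in> P"
    using mult rees_monom_mult[of "p * M * i" c d 0 e g] cd(1,2) by (fastforce simp: rees_monom_power)
  moreover have "rees_monom i a b ^ n \<in> rees J \<and> rees_monom i a b ^ n \<notin> P" for n
  proof (induction n)
    case 0
    then show ?case using one is_subring_rees[OF up_closed] by (simp add: is_subring_def J_def)
  next
    case (Suc n)
    then show ?case using prime iab(1,2) is_subring_rees[OF up_closed] by (auto simp: is_subring_def J_def)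
  qed
  ultimately show False by blast
qed

lemma card_components:
  "finite (irreducible_components (exceptional_divisor J))"
  "card (irreducible_components (exceptional_divisor J)) = card K"
proof -
  let ?E = "exceptional_divisor J"
  have closure: "Abstract_Topology.closure_of ?E {generic_point k} = {P \<in> exceptional_points. primeideal P (rees_ring J) \<and> generic_point k \<subseteq> P}"
    if "k \<in> K" for k
    unfolding exceptional_divisor_J by (rule closure_of_Spec_point[OF generic_point_in_E[OF that] prime_generic_point[OF that]])
  have space: "topspace ?E = {P \<in> exceptional_points. primeideal P (rees_ring J)}"
    by (auto simp: exceptional_divisor_J topspace_Spec)
  have "topspace ?E = (\<Union>k\<in>K. Abstract_Topology.closure_of ?E {generic_point k})"
    using contains_generic_point by (auto simp: closure space)
  moreover have "generic_point k \<in> topspace ?E" if "k \<in> K" for k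
    using generic_point_in_E[OF that] prime_generic_point[OF that] by (simp add: space)
  moreover have "k = l" if "k \<in> K" "l \<in> K" "generic_point k \<in> Abstract_Topology.closure_of ?E {generic_point l}" for k l
    using that generic_point_incomparable[of l k] by (simp add: closure)
  ultimately have "irreducible_components ?E = (\<lambda>k. Abstract_Topology.closure_of ?E {generic_point k}) ` K"
    "inj_on (\<lambda>k. Abstract_Topology.closure_of ?E {generic_point k}) K"
    using irreducible_components_generic_points[OF finite_K, of ?E generic_point] by blast+
  then show "finite (irreducible_components ?E)" "card (irreducible_components ?E) = card K"
    using finite_K by (simp_all add: card_image)
qed

end

section \<open>The polygon of a factorised ideal\<close>

definition edge_exponents :: "nat \<Rightarrow> nat \<Rightarrow> (nat \<times> nat) set" where
  "edge_exponents h k = npow_closure (UNIV + {(h, 0), (0, k)})"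

lemma up_closed_edge_generators: "up_closed (UNIV + {(h, 0), (0, k)})"
  by (subst add.commute) (rule up_closed_plus[OF up_closed_UNIV])

lemma up_closed_edge_exponents: "up_closed (edge_exponents h k)"
  unfolding edge_exponents_def by (rule up_closed_npow_closure[OF up_closed_edge_generators])

lemma nn_eq_exponent_ideal: "nn h k = exponent_ideal (edge_exponents h k)"
proof -
  have "{xy_monom h 0, xy_monom 0 k} = {xy_monom a b | a b. (a, b) \<in> {(h, 0), (0, k)}}" by auto
  then show ?thesis
    unfolding nn_def edge_exponents_def
    by (simp only: genideal_xy_monoms normalisation_exponent_ideal[OF up_closed_edge_generators])
qed

lemma endpoints_in_edge_exponents: "(h, 0) \<in> edge_exponents h k" "(0, k) \<in> edge_exponents h k"
proof -
  have "u \<in> edge_exponents h k" if "u \<in> {(h, 0), (0, k)}" for u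
    using subset_npow_closure[OF up_closed_edge_generators] set_plus_intro[OF UNIV_I[of 0] that]
    unfolding edge_exponents_def by auto
  then show "(h, 0) \<in> edge_exponents h k" "(0, k) \<in> edge_exponents h k" by auto
qed

lemma edge_exponents_weight:
  assumes "(a, b) \<in> edge_exponents h k"
  shows "min (B * h) (A * k) \<le> B * a + A * b"
proof -
  obtain p where p: "p \<ge> 1" "(p * a, p * b) \<in> npow (UNIV + {(h, 0), (0, k)}) p"
    using assms by (auto simp: edge_exponents_def npow_closure_def)
  have "weight A B (min (B * h) (A * k)) p (p * a) (p * b) \<ge> 0"
  proof (rule weight_npow_nonneg[OF _ p(2)])
    fix c d assume "(c, d) \<in> UNIV + {(h, 0), (0, k)}"
    then have "c \<ge> h \<or> d \<ge> k" by (auto elim: exponent_plusE)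
    then show "min (B * h) (A * k) \<le> B * c + A * d"
    proof
      assume "c \<ge> h"
      then have "B * h \<le> B * c" by (rule mult_le_mono2)
      then show ?thesis by linarith
    next
      assume "d \<ge> k"
      then have "A * k \<le> A * d" by (rule mult_le_mono2)
      then show ?thesis by linarith
    qed
  qed
  then have "int (p * min (B * h) (A * k)) \<le> int (p * (B * a + A * b))"
    by (simp add: weight_def algebra_simps)
  then have "p * min (B * h) (A * k) \<le> p * (B * a + A * b)" by (simp only: of_nat_le_iff)
  then show ?thesis using p(1) by simp
qed

lemma npow_edge_exponents_weight:
  assumes "(a, b) \<in> npow (edge_exponents h k) n"
  shows "n * min (B * h) (A * k) \<le> B * a + A * b"
proof -
  have "weight A B (min (B * h) (A * k)) n a b \<ge> 0"
    by (rule weight_npow_nonneg[OF _ assms]) (rule edge_exponents_weight)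
  then show ?thesis unfolding weight_def by (simp add: mult.commute flip: of_nat_mult of_nat_add)
qed

lemma endpoints_in_npow_edge_exponents:
  "(n * h, 0) \<in> npow (edge_exponents h k) n" "(0, n * k) \<in> npow (edge_exponents h k) n"
proof -
  have "(a, b) \<in> npow (edge_exponents h k) 1" if "(a, b) \<in> edge_exponents h k" for a b
    using that by (simp add: plus_UNIV_up_closed up_closed_edge_exponents)
  then show "(n * h, 0) \<in> npow (edge_exponents h k) n" "(0, n * k) \<in> npow (edge_exponents h k) n"
    using npow_scale[OF up_closed_edge_exponents, where m = 1 and n = n] endpoints_in_edge_exponents
    by fastforce+
qed

lemma product_of_edges:
  fixes \<alpha> \<beta> \<delta> :: "nat \<Rightarrow> nat"
  assumes "finite K"
  shows "\<exists>W. up_closed W \<and>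
    finprod (ideals_set Cxy) (\<lambda>k. ideal_power (nn (\<alpha> k) (\<beta> k)) (\<delta> k)) K = exponent_ideal W \<and>
    (\<forall>S\<subseteq>K. ((\<Sum>l\<in>S. \<delta> l * \<alpha> l), (\<Sum>l\<in>K - S. \<delta> l * \<beta> l)) \<in> W) \<and>
    (\<forall>a b A B. (a, b) \<in> W \<longrightarrow> support_min \<alpha> \<beta> \<delta> K A B \<le> B * a + A * b)"
  using assms
proof (induction K rule: finite_induct)
  case empty
  have "finprod (ideals_set Cxy) (\<lambda>k. ideal_power (nn (\<alpha> k) (\<beta> k)) (\<delta> k)) {} = exponent_ideal UNIV"
    by (simp add: comm_monoid.finprod_empty[OF cring.ideals_set_is_comm_monoid[OF cring_Cxy]] exponent_ideal_def)
  then show ?case by (intro exI[of _ UNIV]) (simp add: up_closed_UNIV support_min_def)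
next
  case (insert x K)
  interpret comm_monoid "ideals_set Cxy" by (rule cring.ideals_set_is_comm_monoid[OF cring_Cxy])
  define F where "F k = npow (edge_exponents (\<alpha> k) (\<beta> k)) (\<delta> k)" for k
  have F: "ideal_power (nn (\<alpha> k) (\<beta> k)) (\<delta> k) = exponent_ideal (F k)" "up_closed (F k)" for k
    by (simp_all add: F_def nn_eq_exponent_ideal exponent_ideal_power up_closed_edge_exponents up_closed_npow)
  obtain W where W: "up_closed W"
    "finprod (ideals_set Cxy) (\<lambda>k. ideal_power (nn (\<alpha> k) (\<beta> k)) (\<delta> k)) K = exponent_ideal W"
    "\<And>S. S \<subseteq> K \<Longrightarrow> ((\<Sum>l\<in>S. \<delta> l * \<alpha> l), (\<Sum>l\<in>K - S. \<delta> l * \<beta> l)) \<in> W"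
    "\<And>a b A B. (a, b) \<in> W \<Longrightarrow> support_min \<alpha> \<beta> \<delta> K A B \<le> B * a + A * b"
    using insert.IH by blast
  have "finprod (ideals_set Cxy) (\<lambda>k. ideal_power (nn (\<alpha> k) (\<beta> k)) (\<delta> k)) (insert x K) = exponent_ideal (F x + W)"
    using insert.hyps W(1,2) exponent_ideal_prod[OF F(2) W(1), of x]
    by (subst finprod_insert) (auto simp: F ideal_exponent_ideal)
  moreover have "((\<Sum>l\<in>S. \<delta> l * \<alpha> l), (\<Sum>l\<in>insert x K - S. \<delta> l * \<beta> l)) \<in> F x + W" if S: "S \<subseteq> insert x K" for S
  proof -
    have SK: "S - {x} \<subseteq> K" "finite S" using S insert.hyps by (auto intro: finite_subset)
    show ?thesis
    proof (cases "x \<in> S")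
      case True
      have "(\<delta> x * \<alpha> x, 0) + ((\<Sum>l\<in>S - {x}. \<delta> l * \<alpha> l), (\<Sum>l\<in>K - (S - {x}). \<delta> l * \<beta> l)) \<in> F x + W"
        unfolding F_def by (intro set_plus_intro endpoints_in_npow_edge_exponents W(3) SK)
      moreover have "insert x K - S = K - (S - {x})" using True insert.hyps by auto
      ultimately show ?thesis using sum.remove[OF SK(2) True, of "\<lambda>l. \<delta> l * \<alpha> l"] by simp
    next
      case False
      have "(0, \<delta> x * \<beta> x) + ((\<Sum>l\<in>S. \<delta> l * \<alpha> l), (\<Sum>l\<in>K - S. \<delta> l * \<beta> l)) \<in> F x + W"
        unfolding F_def using SK False by (intro set_plus_intro endpoints_in_npow_edge_exponents W(3)) auto
      moreover have "insert x K - S = insert x (K - S)" using False by auto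
      ultimately show ?thesis using insert.hyps by simp
    qed
  qed
  moreover have "support_min \<alpha> \<beta> \<delta> (insert x K) A B \<le> B * a + A * b" if ab: "(a, b) \<in> F x + W" for a b A B
  proof -
    obtain c d e g where *: "a = c + e" "b = d + g" "(c, d) \<in> F x" "(e, g) \<in> W"
      by (rule exponent_plusE[OF ab]) (rule that)
    have "\<delta> x * min (B * \<alpha> x) (A * \<beta> x) \<le> B * c + A * d"
      using *(3) unfolding F_def by (rule npow_edge_exponents_weight)
    moreover have "support_min \<alpha> \<beta> \<delta> K A B \<le> B * e + A * g" by (rule W(4)[OF *(4)])
    ultimately show ?thesis using insert.hyps by (simp add: support_min_def * algebra_simps)
  qed
  ultimately show ?case using up_closed_plus[OF W(1), of "F x"] by blast
qed

text \<open>The set \<open>W\<close> of the exponents of the factorised ideal is \<open>U\<close> itself for an ideal that factors, and the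
  set of exponents of the normalisation in the second case.\<close>

lemma newton_edges_of_factorisation:
  assumes "up_closed U" and W: "exponent_ideal W = I" "U \<subseteq> W" "W \<subseteq> npow_closure U"
    and fact: "is_factorisation I t \<alpha> \<beta> \<delta>"
  shows "newton_edges U {1..t} \<alpha> \<beta> \<delta>"
proof
  obtain W' where W': "finprod (ideals_set Cxy) (\<lambda>k. ideal_power (nn (\<alpha> k) (\<beta> k)) (\<delta> k)) {1..t} = exponent_ideal W'"
    "\<And>S. S \<subseteq> {1..t} \<Longrightarrow> ((\<Sum>l\<in>S. \<delta> l * \<alpha> l), (\<Sum>l\<in>{1..t} - S. \<delta> l * \<beta> l)) \<in> W'"
    "\<And>a b A B. (a, b) \<in> W' \<Longrightarrow> support_min \<alpha> \<beta> \<delta> {1..t} A B \<le> B * a + A * b"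
    using product_of_edges[of "{1..t}" \<alpha> \<beta> \<delta>] by auto
  then have [simp]: "W' = W"
    using fact W(1) unfolding is_factorisation_def by (metis exponent_ideal_inject)
  show "support_min \<alpha> \<beta> \<delta> {1..t} (\<alpha> k) (\<beta> k) \<le> \<beta> k * a + \<alpha> k * b" if "(a, b) \<in> U" for a b k
    using W'(3) W(2) that by auto
  show "((\<Sum>l\<in>S. \<delta> l * \<alpha> l), (\<Sum>l\<in>{1..t} - S. \<delta> l * \<beta> l)) \<in> npow_closure U" if "S \<subseteq> {1..t}" for S
    using W'(2)[OF that] W(3) by auto
  show "0 < \<alpha> k \<and> 0 < \<beta> k \<and> 0 < \<delta> k" "coprime (\<alpha> k) (\<beta> k)" if "k \<in> {1..t}" for k
    using fact that by (auto simp: is_factorisation_def Suc_le_eq coprime_iff_gcd_eq_1)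
  show "inj_on (\<lambda>k. (\<alpha> k, \<beta> k)) {1..t}" using fact by (simp add: is_factorisation_def)
qed (use assms in auto)

text \<open>The least pure powers of \<open>x\<close> and \<open>y\<close> in \<open>ideal_power (nn \<alpha> \<beta>) \<delta>\<close> have the exponents \<open>\<delta>\<alpha>\<close> and \<open>\<delta>\<beta>\<close>,
  from which \<open>\<delta>\<close> is recovered as their gcd. So distinct indices of a factorisation give
  distinct ideals, and bijectivity reduces to counting components.\<close>

lemma inj_on_edge_powers:
  assumes fact: "is_factorisation I t \<alpha> \<beta> \<delta>"
  shows "inj_on (\<lambda>k. ideal_power (nn (\<alpha> k) (\<beta> k)) (\<delta> k)) {1..t}"
proof (rule inj_onI)
  have le: "\<delta> l * \<alpha> l \<le> \<delta> k * \<alpha> k \<and> \<delta> l * \<beta> l \<le> \<delta> k * \<beta> k"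
    if kl: "k \<in> {1..t}" "l \<in> {1..t}"
      and eq: "npow (edge_exponents (\<alpha> k) (\<beta> k)) (\<delta> k) = npow (edge_exponents (\<alpha> l) (\<beta> l)) (\<delta> l)" for k l
  proof -
    have pos: "\<alpha> l > 0" "\<beta> l > 0" using fact kl by (auto simp: is_factorisation_def Suc_le_eq)
    note ends = endpoints_in_npow_edge_exponents[where h = "\<alpha> k" and k = "\<beta> k" and n = "\<delta> k", unfolded eq]
    have "\<delta> l * min (\<beta> l * \<alpha> l) (\<alpha> l * \<beta> l) \<le> \<beta> l * (\<delta> k * \<alpha> k) + \<alpha> l * 0"
      "\<delta> l * min (\<beta> l * \<alpha> l) (\<alpha> l * \<beta> l) \<le> \<beta> l * 0 + \<alpha> l * (\<delta> k * \<beta> k)"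
      by (rule npow_edge_exponents_weight[OF ends(1)] npow_edge_exponents_weight[OF ends(2)])+
    then have "\<beta> l * (\<delta> l * \<alpha> l) \<le> \<beta> l * (\<delta> k * \<alpha> k)" "\<alpha> l * (\<delta> l * \<beta> l) \<le> \<alpha> l * (\<delta> k * \<beta> k)"
      by (simp_all add: ac_simps)
    then show ?thesis using pos by simp
  qed
  fix k l assume kl: "k \<in> {1..t}" "l \<in> {1..t}"
    and "ideal_power (nn (\<alpha> k) (\<beta> k)) (\<delta> k) = ideal_power (nn (\<alpha> l) (\<beta> l)) (\<delta> l)"
  then have "npow (edge_exponents (\<alpha> k) (\<beta> k)) (\<delta> k) = npow (edge_exponents (\<alpha> l) (\<beta> l)) (\<delta> l)"
    by (simp add: nn_eq_exponent_ideal exponent_ideal_power up_closed_edge_exponents exponent_ideal_inject)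
  then have eq: "\<delta> k * \<alpha> k = \<delta> l * \<alpha> l" "\<delta> k * \<beta> k = \<delta> l * \<beta> l"
    using le kl by (metis le_antisym)+
  have "gcd (\<delta> j * \<alpha> j) (\<delta> j * \<beta> j) = \<delta> j \<and> \<delta> j > 0" if "j \<in> {1..t}" for j
    using fact that by (auto simp: is_factorisation_def Suc_le_eq simp flip: gcd_mult_distrib_nat)
  then have "\<delta> k = \<delta> l" "\<delta> k > 0" using eq kl by metis+
  then show "k = l"
    using eq kl fact by (auto simp: is_factorisation_def dest: inj_onD)
qed

section \<open>Components of the exceptional divisor\<close>

theorem theorem3:
  shows
    "(\<forall>I t \<alpha> \<beta> \<delta>.
        monomial_ideal I \<and> finite_colength I \<and> normal_ideal I \<and> is_factorisation I t \<alpha> \<beta> \<delta> \<longrightarrow>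
        (\<exists>\<phi>. bij_betw \<phi> ((\<lambda>k. ideal_power (nn (\<alpha> k) (\<beta> k)) (\<delta> k)) ` {1..t})
                (irreducible_components (exceptional_divisor I)))) \<and>
     (\<forall>J t \<alpha> \<beta> \<delta>.
        monomial_ideal J \<and> finite_colength J \<and> is_factorisation (normalisation J) t \<alpha> \<beta> \<delta> \<longrightarrow>
        finite (irreducible_components (exceptional_divisor J)) \<and>
        card (irreducible_components (exceptional_divisor J)) \<le> t)"
proof (intro conjI allI impI; elim conjE)
  fix I t \<alpha> \<beta> \<delta>
  assume I: "monomial_ideal I" "is_factorisation I t \<alpha> \<beta> \<delta>"
  obtain U where U: "up_closed U" "I = exponent_ideal U" using monomial_idealE[OF I(1)] .
  interpret newton_edges U "{1..t}" \<alpha> \<beta> \<delta>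
    by (rule newton_edges_of_factorisation[OF U(1) U(2)[symmetric] _ _ I(2)]) (use subset_npow_closure[OF U(1)] in auto)
  have "card ((\<lambda>k. ideal_power (nn (\<alpha> k) (\<beta> k)) (\<delta> k)) ` {1..t}) = t"
    using card_image[OF inj_on_edge_powers[OF I(2)]] by simp
  then show "\<exists>\<phi>. bij_betw \<phi> ((\<lambda>k. ideal_power (nn (\<alpha> k) (\<beta> k)) (\<delta> k)) ` {1..t})
                (irreducible_components (exceptional_divisor I))"
    using card_components by (intro finite_same_card_bij) (simp_all add: J_def U(2))
next
  fix J t \<alpha> \<beta> \<delta>
  assume J: "monomial_ideal J" "is_factorisation (normalisation J) t \<alpha> \<beta> \<delta>"
  obtain U where U: "up_closed U" "J = exponent_ideal U" using monomial_idealE[OF J(1)] .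
  interpret newton_edges U "{1..t}" \<alpha> \<beta> \<delta>
    by (rule newton_edges_of_factorisation[OF U(1) _ _ _ J(2), of "npow_closure U"])
      (use subset_npow_closure[OF U(1)] normalisation_exponent_ideal[OF U(1)] U(2) in auto)
  show "finite (irreducible_components (exceptional_divisor J))"
    "card (irreducible_components (exceptional_divisor J)) \<le> t"
    using card_components by (simp_all add: newton_edges.J_def[OF newton_edges_axioms] U(2))
qed

end
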